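(* Let $n\ge 1$ be an integer, let $F\in\mathbb{C}[x_1,\ldots,x_s]$ be a reduced non-constant polynomial and $X=\mathbf{V}(F)\subset\mathbb{C}^s$. Let $M=\binom{n+s-1}{s}$ and let $\mathcal{J}_n\subset\mathbb{C}[x_1,\ldots,x_s]/\langle F\rangle$ be the ideal generated by (the classes of) the $(M\times M)$-minors of $\mathrm{Jac}_n(F)$. Then the singular locus of $X$ is the zero set of $\mathcal{J}_n$ in $X$.
   Context: $\mathbb{N}=\{0,1,2,\ldots\}$. For $\alpha,\beta\in\mathbb{N}^s$: $|\alpha|=\alpha_1+\cdots+\alpha_s$, $\alpha!=\alpha_1!\cdots\alpha_s!$, $\binom{\alpha}{\beta}=\prod_i\binom{\alpha_i}{\beta_i}$, $\alpha\le\beta$ means $\alpha_i\le\beta_i$ for all $i$, and $\partial^\alpha=\partial^{\alpha_1}_{x_1}\cdots\partial^{\alpha_s}_{x_s}$. Convention: $\partial^{\alpha-\beta}F=0$ if $\alpha_i<\beta_i$ for some $i$. Multi-indices are ordered increasingly by graded lexicographical order with $x_1<x_2<\cdots<x_s$: $\alpha<_{grlex}\beta$ iff $|\alpha|<|\beta|$, or $|\alpha|=|\beta|$ and $\alpha_i<\beta_i$ for the largest index $i$ with $\alpha_i\neq\beta_i$. Let $N=\binom{n+s}{s}$ and $M=\binom{n+s-1}{s}$. For $\beta\in\mathbb{N}^s$ with $0\le|\beta|\le n-1$ put $r_\beta:=\beta!\cdot\Big(\binom{\alpha}{\beta}\frac{\partial^{\alpha-\beta}F}{\alpha!}\ \Big|\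 1\le|\alpha|\le n\Big)$, a vector of $N-1$ polynomials with entries ordered increasingly in $\alpha$ by the graded lexicographical order $<_{grlex}$ (so its $\alpha$-entry is $\frac{\partial^{\alpha-\beta}F}{(\alpha-\beta)!}$ if $\alpha\ge\beta$ and $0$ otherwise). The Jacobian matrix of order $n$ of $F$, $\mathrm{Jac}_n(F)$, is the $M\times(N-1)$ matrix whose rows are the $M$ vectors $r_\beta$, ordered increasingly in $\beta$. *)

theory Defs
  imports
    "HOL-Analysis.Analysis"
    "HOL-Library.Poly_Mapping"
    "HOL-Library.Extended_Nat"
    "HOL-Algebra.Algebra"
    "HOL-Algebra.Algebraic_Closure_Type"
    "Jordan_Normal_Form.Determinant"
    "Jordan_Normal_Form.DL_Submatrix"
begin

text \<open>
  The variables \<open>x\<^sub>1 < \<dots> < x\<^sub>s\<close> are the elements of a finite linearly ordered type \<open>'s\<close>,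
  so that \<open>s = CARD('s)\<close>.  A polynomial is a finitely supported map from
  multi-indices to coefficients, with the convolution product of \<^theory>\<open>HOL-Library.Poly_Mapping\<close>.
  Affine space \<open>\<complex>\<^sup>s\<close> is \<^typ>\<open>complex ^ 's\<close>.
\<close>

type_synonym 's mindex = "'s \<Rightarrow>\<^sub>0 nat"
type_synonym 's cpoly = "('s \<Rightarrow>\<^sub>0 nat) \<Rightarrow>\<^sub>0 complex"

subsection \<open>Multi-indices\<close>

definition mi_deg :: "'s::finite mindex \<Rightarrow> nat" where
  "mi_deg \<alpha> = (\<Sum>i\<in>UNIV. Poly_Mapping.lookup \<alpha> i)"

definition mi_fact :: "'s::finite mindex \<Rightarrow> nat" where
  "mi_fact \<alpha> = (\<Prod>i\<in>UNIV. fact (Poly_Mapping.lookup \<alpha> i))"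

definition mi_binomial :: "'s::finite mindex \<Rightarrow> 's mindex \<Rightarrow> nat" where
  "mi_binomial \<alpha> \<beta> = (\<Prod>i\<in>UNIV. Poly_Mapping.lookup \<alpha> i choose Poly_Mapping.lookup \<beta> i)"

text \<open>Not the order that \<^theory>\<open>HOL-Library.Poly_Mapping\<close> puts on \<^typ>\<open>'s \<Rightarrow>\<^sub>0 nat\<close>.\<close>

definition mi_le :: "'s mindex \<Rightarrow> 's mindex \<Rightarrow> bool" where
  "mi_le \<alpha> \<beta> \<longleftrightarrow> (\<forall>i. Poly_Mapping.lookup \<alpha> i \<le> Poly_Mapping.lookup \<beta> i)"

definition grlex_less :: "'s::{finite,linorder} mindex \<Rightarrow> 's mindex \<Rightarrow> bool" where
  "grlex_less \<alpha> \<beta> \<longleftrightarrow> mi_deg \<alpha> < mi_deg \<beta> \<or>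
     (mi_deg \<alpha> = mi_deg \<beta> \<and>
       (\<exists>i. Poly_Mapping.lookup \<alpha> i < Poly_Mapping.lookup \<beta> i \<and> (\<forall>j>i. Poly_Mapping.lookup \<alpha> j = Poly_Mapping.lookup \<beta> j)))"

text \<open>The increasing enumeration of the multi-indices \<open>\<alpha>\<close> with \<open>a \<le> |\<alpha>| \<le> b\<close>;
  see lemma \<open>mi_list\<close> below for existence and uniqueness.\<close>

definition mi_list :: "nat \<Rightarrow> nat \<Rightarrow> 's::{finite,linorder} mindex list" where
  "mi_list a b = (THE xs. sorted_wrt grlex_less xs \<and> set xs = {\<alpha>. a \<le> mi_deg \<alpha> \<and> mi_deg \<alpha> \<le> b})"

lemma grlex_less_irrefl: "\<not> grlex_less \<alpha> \<alpha>"
  by (simp add: grlex_less_def)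

lemma grlex_less_trans:
  assumes "grlex_less \<alpha> \<beta>" "grlex_less \<beta> \<gamma>"
  shows "grlex_less \<alpha> \<gamma>"
proof (cases "mi_deg \<alpha> = mi_deg \<beta> \<and> mi_deg \<beta> = mi_deg \<gamma>")
  case True
  with assms obtain i j where
    i: "Poly_Mapping.lookup \<alpha> i < Poly_Mapping.lookup \<beta> i"
       "\<forall>k>i. Poly_Mapping.lookup \<alpha> k = Poly_Mapping.lookup \<beta> k" and
    j: "Poly_Mapping.lookup \<beta> j < Poly_Mapping.lookup \<gamma> j"
       "\<forall>k>j. Poly_Mapping.lookup \<beta> k = Poly_Mapping.lookup \<gamma> k"
    by (auto simp: grlex_less_def)
  have "Poly_Mapping.lookup \<alpha> (max i j) < Poly_Mapping.lookup \<gamma> (max i j) \<and>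
      (\<forall>k>max i j. Poly_Mapping.lookup \<alpha> k = Poly_Mapping.lookup \<gamma> k)"
    using i j by (cases i j rule: linorder_cases) (auto simp: max_def)
  with True show ?thesis
    unfolding grlex_less_def by auto
next
  case False
  with assms show ?thesis
    by (auto simp: grlex_less_def)
qed

lemma grlex_less_total:
  assumes "\<alpha> \<noteq> \<beta>"
  shows "grlex_less \<alpha> \<beta> \<or> grlex_less \<beta> \<alpha>"
proof -
  define D where "D = {i. Poly_Mapping.lookup \<alpha> i \<noteq> Poly_Mapping.lookup \<beta> i}"
  have "\<exists>i. Poly_Mapping.lookup \<alpha> i \<noteq> Poly_Mapping.lookup \<beta> i"
    using assms by (auto simp: poly_mapping_eq_iff fun_eq_iff)
  then have "D \<noteq> {}"
    by (simp add: D_def)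
  then have m: "Max D \<in> D"
    by (intro Max_in) auto
  have max: "Poly_Mapping.lookup \<alpha> j = Poly_Mapping.lookup \<beta> j" if "j > Max D" for j
  proof (rule ccontr)
    assume "Poly_Mapping.lookup \<alpha> j \<noteq> Poly_Mapping.lookup \<beta> j"
    then have "j \<le> Max D"
      by (intro Max_ge) (auto simp: D_def)
    with that show False by simp
  qed
  consider "Poly_Mapping.lookup \<alpha> (Max D) < Poly_Mapping.lookup \<beta> (Max D)"
    | "Poly_Mapping.lookup \<beta> (Max D) < Poly_Mapping.lookup \<alpha> (Max D)"
    using m unfolding D_def by fastforce
  then have "(\<exists>i. Poly_Mapping.lookup \<alpha> i < Poly_Mapping.lookup \<beta> i \<and>
        (\<forall>j>i. Poly_Mapping.lookup \<alpha> j = Poly_Mapping.lookup \<beta> j)) \<or>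
      (\<exists>i. Poly_Mapping.lookup \<beta> i < Poly_Mapping.lookup \<alpha> i \<and>
        (\<forall>j>i. Poly_Mapping.lookup \<beta> j = Poly_Mapping.lookup \<alpha> j))"
  proof cases
    case 1
    then show ?thesis using max by blast
  next
    case 2
    then have "Poly_Mapping.lookup \<beta> (Max D) < Poly_Mapping.lookup \<alpha> (Max D) \<and>
        (\<forall>j>Max D. Poly_Mapping.lookup \<beta> j = Poly_Mapping.lookup \<alpha> j)"
      using max by simp
    then show ?thesis by blast
  qed
  then show ?thesis
    unfolding grlex_less_def by (cases "mi_deg \<alpha>" "mi_deg \<beta>" rule: linorder_cases) simp_all
qed

lemma finite_mi_deg_le: "finite {\<alpha> :: 's::finite mindex. mi_deg \<alpha> \<le> b}"
proof -
  let ?A = "{\<alpha> :: 's mindex. mi_deg \<alpha> \<le> b}"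
  have inj: "inj_on Poly_Mapping.lookup ?A"
    by (auto intro!: inj_onI poly_mapping_eqI)
  have "Poly_Mapping.lookup \<alpha> i \<le> b" if "\<alpha> \<in> ?A" for \<alpha> :: "'s mindex" and i
  proof -
    have "Poly_Mapping.lookup \<alpha> i \<le> mi_deg \<alpha>"
      unfolding mi_deg_def by (rule member_le_sum) auto
    with that show ?thesis by simp
  qed
  then have "Poly_Mapping.lookup ` ?A \<subseteq> UNIV \<rightarrow>\<^sub>E {..b}"
    by (auto simp: PiE_def Pi_def extensional_def)
  moreover have "finite ((UNIV :: 's set) \<rightarrow>\<^sub>E {..b})"
    by (intro finite_PiE) auto
  ultimately have "finite (Poly_Mapping.lookup ` ?A)"
    by (rule finite_subset)
  then show ?thesis
    using inj by (rule finite_imageD)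
qed

lemma grlex_minimal_exists:
  assumes "finite A" "A \<noteq> {}"
  shows "\<exists>m\<in>A. \<forall>x\<in>A. x \<noteq> m \<longrightarrow> grlex_less m x"
  using assms
proof (induction A rule: finite_ne_induct)
  case (insert a A)
  then obtain m where m: "m \<in> A" "\<forall>x\<in>A. x \<noteq> m \<longrightarrow> grlex_less m x"
    by blast
  have "a \<noteq> m"
    using insert.hyps m by blast
  from grlex_less_total[OF this] show ?case
  proof
    assume am: "grlex_less a m"
    have "grlex_less a x" if "x \<in> A" for x
      using am m that grlex_less_trans[of a m x] by (cases "x = m") auto
    then show ?thesis by blast
  next
    assume "grlex_less m a"
    then show ?thesis using m by blast
  qed
qed auto

lemma sorted_grlex_exists:
  assumes "finite A"
  shows "\<exists>xs. sorted_wrt grlex_less xs \<and> set xs = A"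
  using assms
proof (induction "card A" arbitrary: A)
  case 0
  then show ?case by (intro exI[of _ "[]"]) auto
next
  case (Suc k)
  have "A \<noteq> {}" using Suc.hyps(2) by auto
  then obtain m where m: "m \<in> A" "\<forall>x\<in>A. x \<noteq> m \<longrightarrow> grlex_less m x"
    using grlex_minimal_exists[OF Suc.prems] by blast
  have "k = card (A - {m})"
    using Suc.hyps(2) m(1) by simp
  from Suc.hyps(1)[OF this] Suc.prems
  obtain xs where xs: "sorted_wrt grlex_less xs" "set xs = A - {m}"
    by blast
  have "sorted_wrt grlex_less (m # xs)" "set (m # xs) = A"
    using xs m by auto
  then show ?case by blast
qed

lemma sorted_grlex_unique:
  assumes "sorted_wrt grlex_less xs" "sorted_wrt grlex_less ys" "set xs = set ys"
  shows "xs = ys"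
  using assms
proof (induction xs arbitrary: ys)
  case (Cons x xs)
  obtain y zs where ys: "ys = y # zs"
    using Cons.prems(3) by (cases ys) auto
  have x: "\<forall>z\<in>set xs. grlex_less x z" and y: "\<forall>z\<in>set zs. grlex_less y z"
    using Cons.prems by (simp_all add: ys)
  have eq: "insert x (set xs) = insert y (set zs)"
    using Cons.prems(3) by (simp add: ys)
  have xy: "x = y"
  proof (rule ccontr)
    assume "x \<noteq> y"
    moreover have "y \<in> insert x (set xs)" "x \<in> insert y (set zs)"
      using eq by (simp, simp flip: eq)
    ultimately have "y \<in> set xs" "x \<in> set zs"
      by simp_all
    then have "grlex_less x y" "grlex_less y x"
      using x y by simp_all
    then show False
      using grlex_less_trans[of x y x] grlex_less_irrefl[of x] by simp
  qed
  have "x \<notin> set xs" "y \<notin> set zs"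
    using x y grlex_less_irrefl[of x] grlex_less_irrefl[of y] by auto
  then have "set xs = set zs"
    using eq xy by (simp add: insert_ident)
  then have "xs = zs"
    using Cons.prems by (intro Cons.IH) (simp_all add: ys)
  with xy show ?case by (simp add: ys)
qed auto

lemma mi_list:
  fixes a b :: nat
  shows "sorted_wrt grlex_less (mi_list a b :: 's::{finite,linorder} mindex list)" (is ?thesis1)
    and "set (mi_list a b :: 's mindex list) = {\<alpha>. a \<le> mi_deg \<alpha> \<and> mi_deg \<alpha> \<le> b}" (is ?thesis2)
proof -
  let ?A = "{\<alpha> :: 's mindex. a \<le> mi_deg \<alpha> \<and> mi_deg \<alpha> \<le> b}"
  have "finite ?A"
    by (rule finite_subset[OF _ finite_mi_deg_le[of b]]) auto
  then have "\<exists>!xs. sorted_wrt grlex_less xs \<and> set xs = ?A"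
    by (intro ex_ex1I sorted_grlex_exists) (auto intro: sorted_grlex_unique)
  from theI'[OF this] have "sorted_wrt grlex_less (mi_list a b :: 's mindex list) \<and> set (mi_list a b :: 's mindex list) = ?A"
    by (simp only: mi_list_def)
  then show ?thesis1 ?thesis2 by blast+
qed

subsection \<open>Polynomials\<close>

definition const_poly :: "complex \<Rightarrow> 's cpoly" where
  "const_poly c = Poly_Mapping.single 0 c"

definition eval_poly :: "'s::finite cpoly \<Rightarrow> complex ^ 's \<Rightarrow> complex" where
  "eval_poly F p = (\<Sum>m\<in>Poly_Mapping.keys F. Poly_Mapping.lookup F m * (\<Prod>i\<in>UNIV. vec_nth p i ^ Poly_Mapping.lookup m i))"

text \<open>For a monomial \<open>m\<close> with \<open>m\<^sub>i = 0\<close> the truncated \<open>m - e\<^sub>i\<close> is harmless: its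
  coefficient is \<open>0\<close>.\<close>

definition partial_deriv :: "'s \<Rightarrow> 's cpoly \<Rightarrow> 's cpoly" where
  "partial_deriv i F =
     (\<Sum>m\<in>Poly_Mapping.keys F. Poly_Mapping.single (m - Poly_Mapping.single i 1) (of_nat (Poly_Mapping.lookup m i) * Poly_Mapping.lookup F m))"

definition mi_deriv :: "'s::{finite,linorder} mindex \<Rightarrow> 's cpoly \<Rightarrow> 's cpoly" where
  "mi_deriv \<alpha> F = foldr (\<lambda>i. partial_deriv i ^^ Poly_Mapping.lookup \<alpha> i) (sorted_list_of_set UNIV) F"

definition mi_deriv_diff :: "'s::{finite,linorder} mindex \<Rightarrow> 's mindex \<Rightarrow> 's cpoly \<Rightarrow> 's cpoly" where
  "mi_deriv_diff \<alpha> \<beta> F = (if mi_le \<beta> \<alpha> then mi_deriv (\<alpha> - \<beta>) F else 0)"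

subsection \<open>The Jacobian matrix of order \<open>n\<close> and its minors\<close>

definition jac_entry :: "'s::{finite,linorder} cpoly \<Rightarrow> 's mindex \<Rightarrow> 's mindex \<Rightarrow> 's cpoly" where
  "jac_entry F \<beta> \<alpha> =
     const_poly (of_nat (mi_fact \<beta>) * (of_nat (mi_binomial \<alpha> \<beta>) / of_nat (mi_fact \<alpha>)))
       * mi_deriv_diff \<alpha> \<beta> F"

definition Jac :: "nat \<Rightarrow> 's::{finite,linorder} cpoly \<Rightarrow> 's cpoly mat" where
  "Jac n F =
     mat ((n + CARD('s) - 1) choose CARD('s)) (((n + CARD('s)) choose CARD('s)) - 1)
       (\<lambda>(i, j). jac_entry F (mi_list 0 (n - 1) ! i) (mi_list 1 n ! j))"

definition minors :: "nat \<Rightarrow> 'a::comm_ring_1 mat \<Rightarrow> 'a set" where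
  "minors k A = {Determinant.det (submatrix A I J) | I J.
     I \<subseteq> {..<dim_row A} \<and> J \<subseteq> {..<dim_col A} \<and> card I = k \<and> card J = k}"

subsection \<open>The coordinate ring\<close>

abbreviation cpoly_ring :: "'s cpoly ring" where
  "cpoly_ring \<equiv> ring_of_type_algebra"

definition coord_ring :: "'s cpoly \<Rightarrow> ('s cpoly set) ring" where
  "coord_ring F = cpoly_ring Quot (PIdl\<^bsub>cpoly_ring\<^esub> F)"

definition residue_class :: "'s cpoly \<Rightarrow> 's cpoly \<Rightarrow> 's cpoly set" where
  "residue_class F G = (PIdl\<^bsub>cpoly_ring\<^esub> F) +>\<^bsub>cpoly_ring\<^esub> G"

definition reduced_ring :: "('a, 'm) ring_scheme \<Rightarrow> bool" where
  "reduced_ring R \<longleftrightarrow> cring R \<and>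
     (\<forall>x\<in>carrier R. \<forall>k::nat. x [^]\<^bsub>R\<^esub> k = \<zero>\<^bsub>R\<^esub> \<longrightarrow> x = \<zero>\<^bsub>R\<^esub>)"

definition jac_ideal :: "nat \<Rightarrow> 's::{finite,linorder} cpoly \<Rightarrow> 's cpoly set set" where
  "jac_ideal n F =
     Idl\<^bsub>coord_ring F\<^esub> (residue_class F ` minors ((n + CARD('s) - 1) choose CARD('s)) (Jac n F))"

subsection \<open>Affine algebraic sets and their singular locus\<close>

definition zero_locus :: "'s::finite cpoly set \<Rightarrow> (complex ^ 's) set" where
  "zero_locus S = {p. \<forall>G\<in>S. eval_poly G p = 0}"

definition vanishing_ideal :: "(complex ^ 's::finite) set \<Rightarrow> 's cpoly set" where
  "vanishing_ideal V = {G. \<forall>p\<in>V. eval_poly G p = 0}"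

definition algebraic_set :: "(complex ^ 's::finite) set \<Rightarrow> bool" where
  "algebraic_set Z \<longleftrightarrow> (\<exists>S. Z = zero_locus S)"

definition irreducible_algebraic_set :: "(complex ^ 's::finite) set \<Rightarrow> bool" where
  "irreducible_algebraic_set Z \<longleftrightarrow> algebraic_set Z \<and> Z \<noteq> {} \<and>
     (\<forall>A B. algebraic_set A \<and> algebraic_set B \<and> Z = A \<union> B \<longrightarrow> Z = A \<or> Z = B)"

definition irreducible_component :: "(complex ^ 's::finite) set \<Rightarrow> (complex ^ 's) set \<Rightarrow> bool" where
  "irreducible_component V Z \<longleftrightarrow> irreducible_algebraic_set Z \<and> Z \<subseteq> V \<and>
     (\<forall>W. irreducible_algebraic_set W \<and> Z \<subseteq> W \<and> W \<subseteq> V \<longrightarrow> W = Z)"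

text \<open>The dimension in the Zariski topology: the supremum of the lengths \<open>k\<close> of chains
  \<open>Z\<^sub>0 \<subset> Z\<^sub>1 \<subset> \<dots> \<subset> Z\<^sub>k \<subseteq> V\<close> of irreducible closed sets.\<close>

definition zariski_dim :: "(complex ^ 's::finite) set \<Rightarrow> enat" where
  "zariski_dim V = Sup {enat k | k. \<exists>Z :: nat \<Rightarrow> (complex ^ 's) set.
     (\<forall>i\<le>k. irreducible_algebraic_set (Z i) \<and> Z i \<subseteq> V) \<and> (\<forall>i<k. Z i \<subset> Z (Suc i))}"

text \<open>The local dimension: the largest dimension of an irreducible component through \<open>p\<close>.\<close>

definition zariski_dim_at :: "(complex ^ 's::finite) set \<Rightarrow> complex ^ 's \<Rightarrow> enat" where
  "zariski_dim_at V p = Sup {zariski_dim Z | Z. irreducible_component V Z \<and> p \<in> Z}"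

text \<open>The Zariski tangent space, translated to the origin.\<close>

definition tangent_space :: "(complex ^ 's::finite) set \<Rightarrow> complex ^ 's \<Rightarrow> (complex ^ 's) set" where
  "tangent_space V p = {v. \<forall>G\<in>vanishing_ideal V.
     (\<Sum>i\<in>UNIV. eval_poly (partial_deriv i G) p * vec_nth v i) = 0}"

text \<open>A point is nonsingular if the complex dimension of the tangent space there is the local
  dimension (equivalently, if its local ring is regular).\<close>

definition singular_locus :: "(complex ^ 's::finite) set \<Rightarrow> (complex ^ 's) set" where
  "singular_locus V = {p \<in> V. enat (vec.dim (tangent_space V p)) \<noteq> zariski_dim_at V p}"

text \<open>The zero set in \<open>V\<close> of a set of residue classes; if \<open>V\<close> is the zero locus of \<open>F\<close>,
  all representatives of a class modulo \<open>F\<close> have the same value at a point of \<open>V\<close>.\<close>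

definition zero_set_in :: "(complex ^ 's::finite) set \<Rightarrow> 's cpoly set set \<Rightarrow> (complex ^ 's) set" where
  "zero_set_in V J = {p \<in> V. \<forall>C\<in>J. \<forall>G\<in>C. eval_poly G p = 0}"

end

theory Submission
  imports Defs "HOL-Complex_Analysis.Conformal_Mappings"
begin

text \<open>
  Let \<open>p\<close> be a point of \<open>X = V(F)\<close>.  Being singular at \<open>p\<close> and the vanishing at \<open>p\<close> of all maximal minors
  of the Jacobian matrix of order \<open>n\<close> are both equivalent to the vanishing of the gradient of \<open>F\<close> at \<open>p\<close>.

  The tangent space.  Since \<open>F\<close> is reduced, the Nullstellensatz for a hypersurface
  (\<open>hypersurface_nullstellensatz\<close>) says that every polynomial vanishing on \<open>X\<close> is a multiple of \<open>F\<close>, so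
  by the product rule the tangent space at \<open>p\<close> is the kernel of the differential of \<open>F\<close>.  Its dimension
  is \<open>s\<close> if the gradient vanishes and \<open>s - 1\<close> otherwise.  The Nullstellensatz itself is a division with
  remainder: in a suitable direction \<open>v\<close> the polynomial \<open>F (x + t v)\<close> has a constant leading
  coefficient in \<open>t\<close>; if \<open>G\<close> vanishes on \<open>X\<close> and \<open>d\<close> is the degree in \<open>t\<close>, then for every fixed \<open>x\<close> the
  polynomial \<open>F (x + t v)\<close> divides \<open>G (x + t v) ^ d\<close>, because the roots of the first are roots of
  the second.  Hence the remainder of the division over the ring of polynomials in \<open>x\<close> is \<open>0\<close>,
  and \<open>t = 0\<close> gives \<open>F dvd G ^ d\<close>.

  The local dimension.  For a chain \<open>Z\<^sub>0 \<subset> \<dots> \<subset> Z\<^sub>k\<close> of irreducible closed sets, choose functions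
  \<open>f\<^sub>i\<close> that vanish on \<open>Z\<^sub>i\<close> but not on \<open>Z\<^sub>i\<^sub>+\<^sub>1\<close>.  They are algebraically independent, while more than \<open>s\<close>
  polynomials in \<open>s\<close> variables are dependent by a count of monomials; so \<open>k \<le> s\<close>
  (\<open>irreducible_chain_length_le\<close>).  The whole space is irreducible, so chains inside \<open>X\<close> have length
  at most \<open>s - 1\<close>.  This already makes every point with vanishing gradient singular.  If
  some partial derivative does not vanish at \<open>p\<close>, then near \<open>p\<close> the hypersurface is the graph of a
  holomorphic function of \<open>s - 1\<close> of the coordinates, and the Zariski closures of the coordinate slices of the
  graph form a chain of length \<open>s - 1\<close> that starts at \<open>p\<close>
  (\<open>irreducible_chain_through_smooth_point\<close>).  Its largest member admits no irreducible enlargement inside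
  \<open>X\<close>, so it is a component, and the local dimension is \<open>s - 1\<close>.

  The minors.  A row \<open>\<beta>\<close> with \<open>|\<beta>| = n - 1\<close> contains only scalar multiples of \<open>F\<close> and of its first partial
  derivatives, and a maximal minor involves every row; so all minors vanish where \<open>F\<close> and the
  gradient do.  Otherwise take the least \<open>i\<close> with \<open>\<partial>\<^sub>i F p \<noteq> 0\<close> and the columns \<open>\<gamma> + e\<^sub>i\<close> with \<open>|\<gamma>| \<le> n - 1\<close>: at \<open>p\<close> this
  minor is upper triangular with nonzero multiples of \<open>\<partial>\<^sub>i F p\<close> on the diagonal.
\<close>

section \<open>Multi-indices\<close>

lemma mi_deg_add: "mi_deg (\<alpha> + \<beta>) = mi_deg \<alpha> + mi_deg \<beta>"
  by (simp add: mi_deg_def lookup_add sum.distrib)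

lemma mi_deg_single: "mi_deg (Poly_Mapping.single i k) = k"
  by (simp add: mi_deg_def lookup_single when_def)

lemma mi_deg_eq_0: "mi_deg \<alpha> = 0 \<longleftrightarrow> \<alpha> = 0"
  by (auto simp: mi_deg_def poly_mapping_eq_iff fun_eq_iff)

lemma mi_deg_eq_1:
  assumes "mi_deg \<alpha> = 1"
  obtains j where "\<alpha> = Poly_Mapping.single j 1"
proof -
  have "\<exists>j. Poly_Mapping.lookup \<alpha> j \<noteq> 0"
    using assms mi_deg_eq_0[of \<alpha>] by (auto simp: poly_mapping_eq_iff fun_eq_iff)
  then obtain j where j: "Poly_Mapping.lookup \<alpha> j \<noteq> 0" by blast
  define \<delta> where "\<delta> = \<alpha> - Poly_Mapping.single j 1"
  have \<alpha>: "\<alpha> = \<delta> + Poly_Mapping.single j 1"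
    using j by (intro poly_mapping_eqI) (auto simp: \<delta>_def lookup_add lookup_minus lookup_single when_def)
  then have "mi_deg \<delta> = 0"
    using assms mi_deg_add[of \<delta> "Poly_Mapping.single j 1"] by (simp add: mi_deg_single)
  then show thesis using that \<alpha> by (simp add: mi_deg_eq_0)
qed

text \<open>
  Adding the slack \<open>b - |m|\<close> as a further entry turns a multi-index of degree at most \<open>b\<close> into a list of
  \<open>s + 1\<close> numbers with sum \<open>b\<close>, and those are counted by stars and bars.
\<close>

lemma card_mi_deg_le: "card {m :: 's::finite mindex. mi_deg m \<le> b} = (b + CARD('s)) choose CARD('s)"
proof -
  define s where "s = CARD('s)"
  obtain h :: "nat \<Rightarrow> 's" where h: "bij_betw h {0..<s} UNIV"
    using ex_bij_betw_nat_finite[of "UNIV :: 's set"] by (auto simp: s_def)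
  define \<phi> where "\<phi> m = (b - mi_deg m) # map (\<lambda>j. Poly_Mapping.lookup m (h j)) [0..<s]" for m :: "'s mindex"
  have deg: "mi_deg m = (\<Sum>j\<leftarrow>[0..<s]. Poly_Mapping.lookup m (h j))" for m
    unfolding mi_deg_def by (simp add: sum.reindex_bij_betw[OF h, symmetric] interv_sum_list_conv_sum_set_nat)
  have "bij_betw \<phi> {m. mi_deg m \<le> b} {l. length l = Suc s \<and> sum_list l = b}"
    unfolding bij_betw_def
  proof
    show "inj_on \<phi> {m. mi_deg m \<le> b}"
    proof (rule inj_onI, rule poly_mapping_eqI)
      fix x y k
      assume "\<phi> x = \<phi> y"
      then have "\<forall>j\<in>{0..<s}. Poly_Mapping.lookup x (h j) = Poly_Mapping.lookup y (h j)"
        by (simp add: \<phi>_def)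
      moreover obtain j where "j \<in> {0..<s}" "k = h j"
        using h by (metis UNIV_I bij_betw_imp_surj_on imageE)
      ultimately show "Poly_Mapping.lookup x k = Poly_Mapping.lookup y k" by simp
    qed
    show "\<phi> ` {m. mi_deg m \<le> b} = {l. length l = Suc s \<and> sum_list l = b}"
    proof (intro equalityI subsetI)
      fix l assume "l \<in> {l. length l = Suc s \<and> sum_list l = b}"
      then obtain x xs where l: "l = x # xs" "length xs = s" "x + sum_list xs = b"
        by (cases l) auto
      define m :: "'s mindex" where "m = Abs_poly_mapping (\<lambda>i. xs ! inv_into {0..<s} h i)"
      have lookup: "Poly_Mapping.lookup m (h j) = xs ! j" if "j < s" for j
        unfolding m_def using that bij_betw_inv_into_left[OF h, of j] by simp
      have xs: "map (\<lambda>j. Poly_Mapping.lookup m (h j)) [0..<s] = xs"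
        using l lookup by (intro nth_equalityI) auto
      then have "mi_deg m = sum_list xs" by (simp add: deg)
      then have "\<phi> m = l" "mi_deg m \<le> b"
        using l xs by (simp_all add: \<phi>_def)
      then show "l \<in> \<phi> ` {m. mi_deg m \<le> b}" by blast
    qed (auto simp: \<phi>_def deg)
  qed
  then have "card {m :: 's mindex. mi_deg m \<le> b} = (b + Suc s - 1) choose b"
    using card_length_sum_list[of "Suc s" b] by (simp add: bij_betw_same_card)
  then show ?thesis
    using binomial_symmetric[of b "b + s"] by (simp add: s_def)
qed

lemma distinct_mi_list: "distinct (mi_list a b :: 's::{finite,linorder} mindex list)"
proof -
  have "distinct xs" if "sorted_wrt grlex_less xs" for xs :: "'s mindex list"
    using that grlex_less_irrefl by (induction xs) auto
  then show ?thesis using mi_list(1) .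
qed

text \<open>
  The two lengths are the dimensions of the Jacobian matrix, so that no entry is read beyond the end of
  a list.
\<close>

lemma length_mi_list_rows:
  assumes "n \<ge> 1"
  shows "length (mi_list 0 (n - 1) :: 's::{finite,linorder} mindex list) = (n + CARD('s) - 1) choose CARD('s)"
proof -
  have "length (mi_list 0 (n - 1) :: 's mindex list) = card {m :: 's mindex. mi_deg m \<le> n - 1}"
    using distinct_card[OF distinct_mi_list[of 0 "n - 1", where 's = 's]] by (simp add: mi_list(2))
  then show ?thesis using assms by (simp add: card_mi_deg_le)
qed

lemma length_mi_list_columns:
  "length (mi_list 1 n :: 's::{finite,linorder} mindex list) = ((n + CARD('s)) choose CARD('s)) - 1"
proof -
  have "length (mi_list 1 n :: 's mindex list) = card {m :: 's mindex. 1 \<le> mi_deg m \<and> mi_deg m \<le> n}"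
    using distinct_card[OF distinct_mi_list[of 1 n, where 's = 's]] by (simp add: mi_list(2))
  also have "{m :: 's mindex. 1 \<le> mi_deg m \<and> mi_deg m \<le> n} = {m. mi_deg m \<le> n} - {0}"
  proof -
    have "1 \<le> mi_deg m \<longleftrightarrow> m \<noteq> 0" for m :: "'s mindex"
      using mi_deg_eq_0[of m] by linarith
    then show ?thesis by auto
  qed
  also have "card \<dots> = card {m :: 's mindex. mi_deg m \<le> n} - 1"
    by (rule card_Diff_singleton) (simp add: mi_deg_def)
  finally show ?thesis by (simp add: card_mi_deg_le)
qed

lemma mi_list_nth_deg:
  assumes "k < length (mi_list a b :: 's::{finite,linorder} mindex list)"
  shows "a \<le> mi_deg (mi_list a b ! k :: 's mindex)" "mi_deg (mi_list a b ! k :: 's mindex) \<le> b"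
  using nth_mem[OF assms] unfolding mi_list(2) by auto

lemma mi_list_nth_less_iff:
  fixes xs :: "'s::{finite,linorder} mindex list"
  assumes "xs = mi_list a b" "u < length xs" "v < length xs"
  shows "grlex_less (xs ! u) (xs ! v) \<longleftrightarrow> u < v"
proof -
  have "grlex_less (xs ! u) (xs ! v)" if "u < v" "v < length xs" for u v
    using mi_list(1)[of a b, where 's = 's] that unfolding assms(1)
    by (simp add: sorted_wrt_iff_nth_less)
  then show ?thesis
    using assms(2,3) grlex_less_irrefl grlex_less_trans by (metis linorder_neqE_nat)
qed

lemma grlex_less_add_right: "grlex_less (\<alpha> + \<gamma>) (\<beta> + \<gamma>) \<longleftrightarrow> grlex_less \<alpha> \<beta>"
  by (simp add: grlex_less_def mi_deg_add lookup_add)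

lemma mi_le_deg_cases:
  assumes "mi_le \<beta> \<alpha>" "mi_deg \<alpha> \<le> mi_deg \<beta> + 1"
  obtains "\<alpha> = \<beta>" | j where "\<alpha> = \<beta> + Poly_Mapping.single j 1"
proof -
  have eq: "\<alpha> = \<beta> + (\<alpha> - \<beta>)"
    using assms(1) by (intro poly_mapping_eqI) (simp add: lookup_add lookup_minus mi_le_def)
  then have "mi_deg (\<alpha> - \<beta>) \<le> 1"
    using assms(2) mi_deg_add[of \<beta> "\<alpha> - \<beta>"] by simp
  then consider "mi_deg (\<alpha> - \<beta>) = 0" | "mi_deg (\<alpha> - \<beta>) = 1" by linarith
  then show thesis
  proof cases
    case 1
    then show thesis using that(1) eq by (simp add: mi_deg_eq_0)
  next
    case 2
    then show thesis using that(2) eq by (metis mi_deg_eq_1)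
  qed
qed

section \<open>Evaluation and differentiation of polynomials\<close>

abbreviation mono_val :: "complex ^ 's::finite \<Rightarrow> 's mindex \<Rightarrow> complex" where
  "mono_val p m \<equiv> \<Prod>i\<in>UNIV. vec_nth p i ^ Poly_Mapping.lookup m i"

lemma eval_poly_superset:
  assumes "finite S" "Poly_Mapping.keys F \<subseteq> S"
  shows "eval_poly F p = (\<Sum>m\<in>S. Poly_Mapping.lookup F m * mono_val p m)"
  unfolding eval_poly_def
  by (rule sum.mono_neutral_left) (use assms in \<open>auto simp: in_keys_iff\<close>)

lemma eval_poly_add: "eval_poly (F + G) p = eval_poly F p + eval_poly G p"
proof -
  let ?S = "Poly_Mapping.keys F \<union> Poly_Mapping.keys G"
  have "eval_poly (F + G) p = (\<Sum>m\<in>?S. Poly_Mapping.lookup (F + G) m * mono_val p m)"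
    by (rule eval_poly_superset) (use keys_add[of F G] in auto)
  also have "\<dots> = (\<Sum>m\<in>?S. Poly_Mapping.lookup F m * mono_val p m) +
      (\<Sum>m\<in>?S. Poly_Mapping.lookup G m * mono_val p m)"
    by (simp add: lookup_add distrib_right sum.distrib)
  finally show ?thesis
    using eval_poly_superset[of ?S F p] eval_poly_superset[of ?S G p] by simp
qed

lemma eval_poly_zero [simp]: "eval_poly 0 p = 0"
  by (simp add: eval_poly_def)

lemma eval_poly_single: "eval_poly (Poly_Mapping.single m c) p = c * mono_val p m"
  by (simp add: eval_poly_def)

lemma eval_poly_sum: "eval_poly (\<Sum>a\<in>A. f a) p = (\<Sum>a\<in>A. eval_poly (f a) p)"
  by (induction A rule: infinite_finite_induct) (simp_all add: eval_poly_add)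

lemma poly_mapping_eq_sum_single:
  "F = (\<Sum>m\<in>Poly_Mapping.keys F. Poly_Mapping.single m (Poly_Mapping.lookup F m))"
  by (rule poly_mapping_eqI) (simp add: lookup_sum lookup_single when_def in_keys_iff)

lemma eval_poly_mult: "eval_poly (F * G) p = eval_poly F p * eval_poly G p"
proof -
  let ?s = "\<lambda>F m. Poly_Mapping.single m (Poly_Mapping.lookup F m)"
  have single: "eval_poly (?s F m * ?s G m') p = eval_poly (?s F m) p * eval_poly (?s G m') p" for m m'
    by (simp add: mult_single eval_poly_single lookup_add power_add prod.distrib)
  have "F * G = (\<Sum>m\<in>Poly_Mapping.keys F. \<Sum>m'\<in>Poly_Mapping.keys G. ?s F m * ?s G m')"
    by (subst poly_mapping_eq_sum_single[of F], subst poly_mapping_eq_sum_single[of G])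
       (simp add: sum_product)
  then have "eval_poly (F * G) p =
      (\<Sum>m\<in>Poly_Mapping.keys F. eval_poly (?s F m) p) * (\<Sum>m'\<in>Poly_Mapping.keys G. eval_poly (?s G m') p)"
    by (simp add: eval_poly_sum single sum_product)
  then show ?thesis
    by (simp only: eval_poly_sum[symmetric] poly_mapping_eq_sum_single[symmetric])
qed

lemma eval_const_poly [simp]: "eval_poly (const_poly c) p = c"
  by (simp add: const_poly_def eval_poly_single)

lemma const_poly_0 [simp]: "const_poly 0 = 0" and const_poly_1 [simp]: "const_poly 1 = 1"
  by (simp_all add: const_poly_def)

lemma const_poly_power: "const_poly c ^ k = const_poly (c ^ k)"
  by (induction k) (simp_all add: const_poly_def mult_single flip: single_one)

lemma eval_poly_one [simp]: "eval_poly 1 p = 1"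
  using eval_const_poly[of 1 p] by simp

lemma eval_poly_uminus: "eval_poly (- F) p = - eval_poly F p"
  using eval_poly_add[of F "- F" p] by (simp add: eq_neg_iff_add_eq_0 add.commute)

lemma eval_poly_minus: "eval_poly (F - G) p = eval_poly F p - eval_poly G p"
  using eval_poly_add[of F "- G" p] by (simp add: eval_poly_uminus)

lemma comm_ring_hom_eval_poly: "comm_ring_hom (\<lambda>F. eval_poly F p)"
  by unfold_locales (simp_all add: eval_poly_add eval_poly_mult)

lemma eval_poly_power: "eval_poly (F ^ k) p = eval_poly F p ^ k"
  by (induction k) (simp_all add: eval_poly_mult)

lemma eval_poly_prod: "eval_poly (\<Prod>a\<in>A. f a) p = (\<Prod>a\<in>A. eval_poly (f a) p)"
  by (induction A rule: infinite_finite_induct) (simp_all add: eval_poly_mult)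

definition var_poly :: "'s \<Rightarrow> 's cpoly" where
  "var_poly i = Poly_Mapping.single (Poly_Mapping.single i 1) 1"

lemma eval_var_poly [simp]: "eval_poly (var_poly i) p = vec_nth p i"
proof -
  have "mono_val p (Poly_Mapping.single i 1) = (\<Prod>j\<in>UNIV. if j = i then vec_nth p j else 1)"
    by (intro prod.cong) (auto simp: lookup_single when_def)
  also have "\<dots> = vec_nth p i" by simp
  finally show ?thesis
    unfolding var_poly_def eval_poly_single by simp
qed

text \<open>
  One variable at a time: as a function of a single coordinate the sum is a univariate polynomial, so its
  coefficients, which are sums over the remaining variables, all vanish.  The index type is arbitrary and
  only the exponents in \<open>S\<close> have to separate the indices, because the induction removes variables
  while it keeps the family of exponents.
\<close>

lemma monomials_independent_on:
  fixes c :: "'a \<Rightarrow> complex" and e :: "'a \<Rightarrow> 's \<Rightarrow> nat"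
  assumes "finite S" "finite A" "inj_on (\<lambda>a. restrict (e a) S) A"
    and "\<And>x. (\<Sum>a\<in>A. c a * (\<Prod>i\<in>S. x i ^ e a i)) = 0" and "a \<in> A"
  shows "c a = 0"
  using assms
proof (induction S arbitrary: A a rule: finite_induct)
  case empty
  then have "A = {a}"
    by (auto simp: inj_on_def)
  then show ?case using empty.prems(3) by simp
next
  case (insert t S)
  define k where "k = e a t"
  \<comment> \<open>the terms that contribute to the coefficient of \<open>z ^ k\<close>, where \<open>z\<close> is the value of variable \<open>t\<close>\<close>
  define B where "B = {b\<in>A. e b t = k}"
  have "(\<Sum>b\<in>B. c b * (\<Prod>i\<in>S. x i ^ e b i)) = 0" for x :: "'s \<Rightarrow> complex"
  proof -
    define q where "q = (\<Sum>b\<in>A. Polynomial.monom (c b * (\<Prod>i\<in>S. x i ^ e b i)) (e b t))"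
    have "poly q z = 0" for z
    proof -
      have "poly q z = (\<Sum>b\<in>A. c b * (\<Prod>i\<in>insert t S. (x(t := z)) i ^ e b i))"
        unfolding q_def poly_sum poly_monom
      proof (rule sum.cong)
        fix b
        have "(\<Prod>i\<in>S. (x(t := z)) i ^ e b i) = (\<Prod>i\<in>S. x i ^ e b i)"
          using insert.hyps by (intro prod.cong) auto
        then show "c b * (\<Prod>i\<in>S. x i ^ e b i) * z ^ e b t =
            c b * (\<Prod>i\<in>insert t S. (x(t := z)) i ^ e b i)"
          using insert.hyps by simp
      qed simp
      then show ?thesis using insert.prems(3) by simp
    qed
    then have "q = 0"
      using poly_all_0_iff_0 by blast
    then have "Polynomial.coeff q k = 0" by simp
    moreover have "Polynomial.coeff q k = (\<Sum>b\<in>A. if e b t = k then c b * (\<Prod>i\<in>S. x i ^ e b i) else 0)"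
      unfolding q_def by (simp add: Polynomial.coeff_sum)
    moreover have "\<dots> = (\<Sum>b\<in>B. c b * (\<Prod>i\<in>S. x i ^ e b i))"
      unfolding B_def using insert.prems(1) by (simp add: sum.inter_filter)
    ultimately show ?thesis by simp
  qed
  moreover have "inj_on (\<lambda>b. restrict (e b) S) B"
  proof (rule inj_onI)
    fix b b'
    assume b: "b \<in> B" "b' \<in> B" and eq: "restrict (e b) S = restrict (e b') S"
    have "e b i = e b' i" if "i \<in> S" for i
      using fun_cong[OF eq, of i] that by simp
    then have "restrict (e b) (insert t S) = restrict (e b') (insert t S)"
      using b by (auto simp: B_def fun_eq_iff restrict_def)
    then show "b = b'"
      using inj_onD[OF insert.prems(2), of b b'] b unfolding B_def by blast
  qed
  moreover have "finite B" "a \<in> B"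
    using insert.prems(1,4) by (auto simp: B_def k_def)
  ultimately show ?case
    by (intro insert.IH[of B a])
qed

lemma eval_poly_inject:
  assumes "\<And>p. eval_poly F p = eval_poly G p"
  shows "F = G"
proof (rule ccontr)
  assume "F \<noteq> G"
  define H where "H = F - G"
  have "H \<noteq> 0" using \<open>F \<noteq> G\<close> by (simp add: H_def)
  then obtain m where m: "m \<in> Poly_Mapping.keys H"
    using keys_eq_empty by blast
  have "Poly_Mapping.lookup H m = 0"
  proof (rule monomials_independent_on[where S = UNIV and A = "Poly_Mapping.keys H" and e = Poly_Mapping.lookup])
    show "inj_on (\<lambda>m. restrict (Poly_Mapping.lookup m) UNIV) (Poly_Mapping.keys H)"
      by (auto intro!: inj_onI poly_mapping_eqI simp: restrict_def)
    fix x :: "'a \<Rightarrow> complex"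
    have "eval_poly H (\<chi> i. x i) = 0"
      using assms by (simp add: H_def eval_poly_minus)
    then show "(\<Sum>m\<in>Poly_Mapping.keys H. Poly_Mapping.lookup H m * (\<Prod>i\<in>UNIV. x i ^ Poly_Mapping.lookup m i)) = 0"
      by (simp add: eval_poly_def)
  qed (use m in auto)
  then show False using m by (simp add: in_keys_iff)
qed

lemma eval_poly_eq_0_imp_eq_0:
  assumes "\<And>p. eval_poly F p = 0"
  shows "F = 0"
  using eval_poly_inject[of F 0] assms by simp

lemma const_poly_eq_0_iff: "const_poly c = (0 :: 's cpoly) \<longleftrightarrow> c = 0"
proof
  assume "const_poly c = (0 :: 's cpoly)"
  then have "Poly_Mapping.lookup (const_poly c :: 's cpoly) 0 = 0" by simp
  then show "c = 0" by (simp add: const_poly_def)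
qed simp

lemma const_poly_mult: "const_poly a * const_poly b = (const_poly (a * b) :: 's::finite cpoly)"
  by (rule eval_poly_inject) (simp add: eval_poly_mult)

lemma const_poly_sum: "(\<Sum>x\<in>A. const_poly (f x)) = (const_poly (\<Sum>x\<in>A. f x) :: 's::finite cpoly)"
  by (rule eval_poly_inject) (simp add: eval_poly_sum)

lemma const_poly_prod: "(\<Prod>x\<in>A. const_poly (f x)) = (const_poly (\<Prod>x\<in>A. f x) :: 's::finite cpoly)"
  by (rule eval_poly_inject) (simp add: eval_poly_prod)

text \<open>
  The truncated exponent \<open>m\<^sub>i - 1\<close> is harmless for \<open>m\<^sub>i = 0\<close>, because the factor \<open>m\<^sub>i\<close> is then \<open>0\<close>.
\<close>

lemma eval_partial_deriv:
  "eval_poly (partial_deriv i F) p =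
    (\<Sum>m\<in>Poly_Mapping.keys F. Poly_Mapping.lookup F m *
      (of_nat (Poly_Mapping.lookup m i) * vec_nth p i ^ (Poly_Mapping.lookup m i - 1) *
        (\<Prod>j\<in>UNIV - {i}. vec_nth p j ^ Poly_Mapping.lookup m j)))"
proof -
  have "mono_val p (m - Poly_Mapping.single i 1) =
      vec_nth p i ^ (Poly_Mapping.lookup m i - 1) *
        (\<Prod>j\<in>UNIV - {i}. vec_nth p j ^ Poly_Mapping.lookup m j)" for m
    by (subst prod.remove[of _ i])
       (auto simp: lookup_minus lookup_single when_def intro!: prod.cong)
  then show ?thesis
    unfolding partial_deriv_def by (simp add: eval_poly_sum eval_poly_single mult_ac)
qed

lemma has_derivative_eval_poly:
  fixes F :: "'s::finite cpoly"
  shows "((\<lambda>p. eval_poly F p) has_derivative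
    (\<lambda>v. \<Sum>i\<in>UNIV. eval_poly (partial_deriv i F) p * vec_nth v i)) (at p)"
proof -
  have mono: "((\<lambda>p. mono_val p m) has_derivative
      (\<lambda>v. \<Sum>i\<in>UNIV. of_nat (Poly_Mapping.lookup m i) * vec_nth v i *
        vec_nth p i ^ (Poly_Mapping.lookup m i - 1) *
        (\<Prod>j\<in>UNIV - {i}. vec_nth p j ^ Poly_Mapping.lookup m j))) (at p)" for m :: "'s mindex"
  proof -
    have "((\<lambda>p. vec_nth p i ^ Poly_Mapping.lookup m i) has_derivative
        (\<lambda>v. of_nat (Poly_Mapping.lookup m i) * vec_nth v i *
          vec_nth p i ^ (Poly_Mapping.lookup m i - 1))) (at p)" for i
      by (rule has_derivative_power[OF bounded_linear.has_derivative[OF bounded_linear_vec_nth has_derivative_ident]])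
    from has_derivative_prod[OF this, where I = UNIV] show ?thesis by simp
  qed
  have "((\<lambda>p. eval_poly F p) has_derivative (\<lambda>v. \<Sum>m\<in>Poly_Mapping.keys F. Poly_Mapping.lookup F m *
      (\<Sum>i\<in>UNIV. of_nat (Poly_Mapping.lookup m i) * vec_nth v i *
        vec_nth p i ^ (Poly_Mapping.lookup m i - 1) *
        (\<Prod>j\<in>UNIV - {i}. vec_nth p j ^ Poly_Mapping.lookup m j)))) (at p)"
    unfolding eval_poly_def by (intro has_derivative_sum has_derivative_mult_right mono)
  moreover have "(\<Sum>m\<in>Poly_Mapping.keys F. Poly_Mapping.lookup F m *
      (\<Sum>i\<in>UNIV. of_nat (Poly_Mapping.lookup m i) * vec_nth v i *
        vec_nth p i ^ (Poly_Mapping.lookup m i - 1) *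
        (\<Prod>j\<in>UNIV - {i}. vec_nth p j ^ Poly_Mapping.lookup m j))) =
      (\<Sum>i\<in>UNIV. eval_poly (partial_deriv i F) p * vec_nth v i)" for v
    unfolding eval_partial_deriv sum_distrib_left sum_distrib_right
    by (subst sum.swap) (simp add: mult_ac)
  ultimately show ?thesis by simp
qed

lemma continuous_on_eval_poly: "continuous_on S (\<lambda>p. eval_poly F p)"
  unfolding eval_poly_def by (intro continuous_intros)

text \<open>
  The product rule for the formal derivative follows from the one for the differential of the polynomial
  function, evaluated on a coordinate vector.
\<close>

lemma eval_partial_deriv_mult:
  "eval_poly (partial_deriv i (F * G)) p =
    eval_poly (partial_deriv i F) p * eval_poly G p + eval_poly F p * eval_poly (partial_deriv i G) p"
proof -
  let ?D = "\<lambda>F v. \<Sum>j\<in>UNIV. eval_poly (partial_deriv j F) p * vec_nth v j"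
  have at_axis: "?D F (axis i 1) = eval_poly (partial_deriv i F) p" for F
    by (simp add: axis_def if_distrib cong: if_cong)
  have "((\<lambda>p. eval_poly (F * G) p) has_derivative
      (\<lambda>v. eval_poly F p * ?D G v + ?D F v * eval_poly G p)) (at p)"
    unfolding eval_poly_mult by (intro has_derivative_mult has_derivative_eval_poly)
  from has_derivative_unique[OF this has_derivative_eval_poly]
  have "eval_poly F p * ?D G (axis i 1) + ?D F (axis i 1) * eval_poly G p = ?D (F * G) (axis i 1)"
    by (rule fun_cong)
  then show ?thesis by (simp only: at_axis add.commute)
qed

section \<open>The Nullstellensatz for a hypersurface\<close>

text \<open>
  The next lemmas give the top coefficient of a product of linear polynomials in terms of degree bounds.
  Bounds are more convenient than exact degrees, which drop when some leading coefficient is \<open>0\<close>.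
\<close>

lemma coeff_mult_bounded_degrees:
  fixes f g :: "'a::comm_semiring_1 poly"
  assumes "Polynomial.degree f \<le> a" "Polynomial.degree g \<le> b"
  shows "Polynomial.coeff (f * g) (a + b) = Polynomial.coeff f a * Polynomial.coeff g b"
proof (cases "Polynomial.degree f = a \<and> Polynomial.degree g = b")
  case True
  then show ?thesis using coeff_mult_degree_sum by blast
next
  case False
  then have "Polynomial.degree (f * g) < a + b"
    using assms degree_mult_le[of f g] by linarith
  moreover have "Polynomial.coeff f a * Polynomial.coeff g b = 0"
    using False assms by (auto simp: coeff_eq_0)
  ultimately show ?thesis by (simp add: coeff_eq_0)
qed

lemma power_linear_degree_top_coeff:
  fixes a b :: "'a::comm_semiring_1"
  shows "Polynomial.degree ([:a, b:] ^ k) \<le> k" "Polynomial.coeff ([:a, b:] ^ k) k = b ^ k"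
proof -
  have "Polynomial.degree ([:a, b:] ^ k) \<le> k \<and> Polynomial.coeff ([:a, b:] ^ k) k = b ^ k"
  proof (induction k)
    case (Suc k)
    have lin: "Polynomial.degree [:a, b:] \<le> 1" by simp
    have "Polynomial.degree ([:a, b:] * [:a, b:] ^ k) \<le> 1 + k"
      using degree_mult_le[of "[:a, b:]" "[:a, b:] ^ k"] lin Suc by linarith
    moreover have "Polynomial.coeff ([:a, b:] * [:a, b:] ^ k) (1 + k) = b * b ^ k"
      using coeff_mult_bounded_degrees[OF lin, of "[:a, b:] ^ k" k] Suc by simp
    ultimately show ?case by simp
  qed simp
  then show "Polynomial.degree ([:a, b:] ^ k) \<le> k" "Polynomial.coeff ([:a, b:] ^ k) k = b ^ k"
    by auto
qed

lemma prod_linear_degree_top_coeff: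
  fixes a b :: "'i \<Rightarrow> 'a::comm_semiring_1"
  assumes "finite I"
  shows "Polynomial.degree (\<Prod>i\<in>I. [:a i, b i:] ^ k i) \<le> sum k I"
    and "Polynomial.coeff (\<Prod>i\<in>I. [:a i, b i:] ^ k i) (sum k I) = (\<Prod>i\<in>I. b i ^ k i)"
proof -
  have "Polynomial.degree (\<Prod>i\<in>I. [:a i, b i:] ^ k i) \<le> sum k I \<and>
      Polynomial.coeff (\<Prod>i\<in>I. [:a i, b i:] ^ k i) (sum k I) = (\<Prod>i\<in>I. b i ^ k i)"
    using assms
  proof (induction I rule: finite_induct)
    case (insert j I)
    let ?f = "[:a j, b j:] ^ k j" and ?g = "\<Prod>i\<in>I. [:a i, b i:] ^ k i"
    have "Polynomial.degree (?f * ?g) \<le> k j + sum k I"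
      using degree_mult_le[of ?f ?g] power_linear_degree_top_coeff(1)[of "a j" "b j" "k j"] insert.IH
      by linarith
    moreover have "Polynomial.coeff (?f * ?g) (k j + sum k I) = b j ^ k j * (\<Prod>i\<in>I. b i ^ k i)"
      using coeff_mult_bounded_degrees[OF power_linear_degree_top_coeff(1)[of "a j" "b j" "k j"], of ?g "sum k I"]
        insert.IH power_linear_degree_top_coeff(2)[of "a j" "b j" "k j"] by simp
    ultimately show ?case using insert.hyps by simp
  qed simp
  then show "Polynomial.degree (\<Prod>i\<in>I. [:a i, b i:] ^ k i) \<le> sum k I"
    and "Polynomial.coeff (\<Prod>i\<in>I. [:a i, b i:] ^ k i) (sum k I) = (\<Prod>i\<in>I. b i ^ k i)"
    by auto
qed

text \<open>The polynomial \<open>F (x + t v)\<close> in \<open>t\<close>, with coefficients in the polynomial ring in \<open>x\<close>.\<close>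

definition line_poly :: "complex ^ 's \<Rightarrow> 's::finite cpoly \<Rightarrow> 's cpoly poly" where
  "line_poly v F = (\<Sum>m\<in>Poly_Mapping.keys F. Polynomial.smult (const_poly (Poly_Mapping.lookup F m))
     (\<Prod>i\<in>UNIV. [:var_poly i, const_poly (vec_nth v i):] ^ Poly_Mapping.lookup m i))"

lemma poly_map_eval_poly:
  "poly (map_poly (\<lambda>c. eval_poly c p) Q) z = eval_poly (poly Q (const_poly z)) p"
  by (induction Q) (simp_all add: map_poly_pCons eval_poly_add eval_poly_mult)

lemma eval_line_poly: "eval_poly (poly (line_poly v F) (const_poly z)) p = eval_poly F (p + z *s v)"
  unfolding line_poly_def
  by (simp add: poly_sum poly_prod eval_poly_sum eval_poly_mult eval_poly_prod eval_poly_power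
      eval_poly_add, simp add: eval_poly_def)

lemma coeff_0_line_poly: "Polynomial.coeff (line_poly v F) 0 = F"
proof (rule eval_poly_inject)
  fix p
  show "eval_poly (Polynomial.coeff (line_poly v F) 0) p = eval_poly F p"
    using eval_line_poly[of v F 0 p] by (simp add: poly_0_coeff_0)
qed

lemma line_poly_degree_le:
  assumes "\<And>m. m \<in> Poly_Mapping.keys F \<Longrightarrow> mi_deg m \<le> d"
  shows "Polynomial.degree (line_poly v F) \<le> d"
    and "Polynomial.coeff (line_poly v F) d =
      const_poly (\<Sum>m\<in>{m\<in>Poly_Mapping.keys F. mi_deg m = d}. Poly_Mapping.lookup F m * mono_val v m)"
proof -
  let ?P = "\<lambda>m. \<Prod>i\<in>UNIV. [:var_poly i, const_poly (vec_nth v i):] ^ Poly_Mapping.lookup m i"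
  have deg: "Polynomial.degree (?P m) \<le> mi_deg m" for m
    unfolding mi_deg_def by (rule prod_linear_degree_top_coeff) simp
  show "Polynomial.degree (line_poly v F) \<le> d"
    unfolding line_poly_def
  proof (rule degree_sum_le)
    fix m
    assume "m \<in> Poly_Mapping.keys F"
    then have "Polynomial.degree (?P m) \<le> d"
      using deg[of m] assms[of m] by simp
    then show "Polynomial.degree (Polynomial.smult (const_poly (Poly_Mapping.lookup F m)) (?P m)) \<le> d"
      using degree_smult_le[of "const_poly (Poly_Mapping.lookup F m)" "?P m"] by linarith
  qed simp
  have "Polynomial.coeff (?P m) d = (if mi_deg m = d then const_poly (mono_val v m) else 0)"
    if "m \<in> Poly_Mapping.keys F" for m
  proof (cases "mi_deg m = d")
    case True
    have "Polynomial.coeff (?P m) (mi_deg m) = (\<Prod>i\<in>UNIV. const_poly (vec_nth v i) ^ Poly_Mapping.lookup m i)"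
      unfolding mi_deg_def by (rule prod_linear_degree_top_coeff) simp
    then show ?thesis using True by (simp add: const_poly_power const_poly_prod)
  next
    case False
    then have "Polynomial.degree (?P m) < d" using deg[of m] assms[OF that] by simp
    then show ?thesis using False by (simp add: coeff_eq_0)
  qed
  then have "Polynomial.coeff (line_poly v F) d = (\<Sum>m\<in>Poly_Mapping.keys F.
      if mi_deg m = d then const_poly (Poly_Mapping.lookup F m * mono_val v m) else 0)"
    unfolding line_poly_def coeff_sum coeff_smult
    by (intro sum.cong) (simp_all add: const_poly_mult)
  then show "Polynomial.coeff (line_poly v F) d =
      const_poly (\<Sum>m\<in>{m\<in>Poly_Mapping.keys F. mi_deg m = d}. Poly_Mapping.lookup F m * mono_val v m)"
    by (simp add: const_poly_sum[symmetric] sum.inter_filter if_distrib[of const_poly] cong: if_cong)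
qed

text \<open>
  If \<open>d\<close> is the total degree of \<open>F\<close>, then the coefficient of \<open>t ^ d\<close> in \<open>F (x + t v)\<close> is the value at \<open>v\<close>
  of the homogeneous part of degree \<open>d\<close>.  That part is a nonzero polynomial, so some \<open>v\<close> gives a nonzero value.
  This replaces a linear change of coordinates that makes \<open>F\<close> monic in one variable.
\<close>

lemma exists_line_poly_const_lead_coeff:
  fixes F :: "'s::finite cpoly"
  assumes "\<nexists>c. F = const_poly c"
  obtains v c where "c \<noteq> 0" "Polynomial.degree (line_poly v F) > 0"
    "Polynomial.lead_coeff (line_poly v F) = const_poly c"
proof -
  have "F \<noteq> 0" using assms const_poly_0 by metis
  then have ne: "Poly_Mapping.keys F \<noteq> {}" by simp
  define d where "d = Max (mi_deg ` Poly_Mapping.keys F)"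
  have le: "mi_deg m \<le> d" if "m \<in> Poly_Mapping.keys F" for m
    using that by (simp add: d_def)
  have "d \<in> mi_deg ` Poly_Mapping.keys F"
    unfolding d_def using ne by (intro Max_in) auto
  then obtain m0 where m0: "m0 \<in> Poly_Mapping.keys F" "mi_deg m0 = d" by auto
  \<comment> \<open>the homogeneous part of top degree\<close>
  define T where "T = (\<Sum>m\<in>{m\<in>Poly_Mapping.keys F. mi_deg m = d}.
    Poly_Mapping.single m (Poly_Mapping.lookup F m))"
  have "Poly_Mapping.lookup T m0 \<noteq> 0"
    using m0 unfolding T_def by (simp add: lookup_sum lookup_single when_def in_keys_iff)
  then have "T \<noteq> 0" by auto
  then obtain v where "eval_poly T v \<noteq> 0"
    using eval_poly_eq_0_imp_eq_0 by blast
  then have c: "(\<Sum>m\<in>{m\<in>Poly_Mapping.keys F. mi_deg m = d}. Poly_Mapping.lookup F m * mono_val v m) \<noteq> 0"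
    (is "?c \<noteq> 0") by (simp add: T_def eval_poly_sum eval_poly_single)
  let ?l = "line_poly v F"
  have coeff: "Polynomial.coeff ?l d = const_poly ?c"
    by (rule line_poly_degree_le(2)[OF le])
  have "const_poly ?c \<noteq> (0 :: 's cpoly)"
    using c by (simp add: const_poly_eq_0_iff)
  then have deg: "Polynomial.degree ?l = d"
    using coeff line_poly_degree_le(1)[OF le, where v = v] le_degree[of ?l d] by (metis le_antisym)
  have "d > 0"
  proof (rule ccontr)
    assume "\<not> d > 0"
    then have "Polynomial.degree (line_poly v F) = 0" using deg by simp
    then have "F = const_poly ?c"
      using coeff coeff_0_line_poly[of v F] deg by simp
    then show False using assms by blast
  qed
  then show thesis using that[OF c, of v] coeff deg by simp
qed

text \<open>
  Divide \<open>G (x + t v) ^ d\<close> by \<open>F (x + t v)\<close> in \<open>t\<close>, where \<open>d\<close> is the degree of the divisor.  At every \<open>x\<close> the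
  Nullstellensatz in one variable makes the divisor divide the dividend, hence the remainder, whose degree
  is too small for that unless it vanishes.  A polynomial that vanishes at every \<open>x\<close> is \<open>0\<close>, so
  the division is exact, and its constant term in \<open>t\<close> is the claim.
\<close>

theorem hypersurface_nullstellensatz:
  fixes F G :: "'s::{finite,linorder} cpoly"
  assumes "\<nexists>c. F = const_poly c" and "G \<in> vanishing_ideal (zero_locus {F})"
  shows "\<exists>k. F dvd G ^ k"
proof -
  obtain v c where c: "c \<noteq> 0" and deg: "Polynomial.degree (line_poly v F) > 0"
    and lead: "Polynomial.lead_coeff (line_poly v F) = const_poly c"
    using exists_line_poly_const_lead_coeff[OF assms(1)] .
  let ?f = "line_poly v F" and ?g = "line_poly v G"
  define d where "d = Polynomial.degree ?f"
  define e where "e = Suc (Polynomial.degree (?g ^ d)) - d"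
  have nz: "?f \<noteq> 0" using deg by auto
  obtain q r where qr: "pseudo_divmod (?g ^ d) ?f = (q, r)" by fastforce
  have div: "Polynomial.smult (const_poly (c ^ e)) (?g ^ d) = ?f * q + r"
    and r: "r = 0 \<or> Polynomial.degree r < d"
    using pseudo_divmod[OF nz qr] lead by (simp_all add: e_def d_def const_poly_power)
  have "r = 0"
  proof (rule poly_eqI, rule eval_poly_inject)
    fix k p
    \<comment> \<open>specialization of the coefficients at the point \<open>p\<close>; the degree of the divisor is preserved\<close>
    define at_p :: "'s cpoly poly \<Rightarrow> complex poly" where "at_p = map_poly (\<lambda>c. eval_poly c p)"
    have coeff_at: "Polynomial.coeff (at_p Q) i = eval_poly (Polynomial.coeff Q i) p" for Q i
      by (simp add: at_p_def coeff_map_poly)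
    have deg_at: "Polynomial.degree (at_p Q) \<le> Polynomial.degree Q" for Q
      unfolding at_p_def by (rule map_poly_degree_leq)
    have poly_at: "poly (at_p Q) z = eval_poly (poly Q (const_poly z)) p" for Q z
      by (simp add: at_p_def poly_map_eval_poly)
    have at_0: "at_p 0 = 0" by (simp add: at_p_def)
    have lead_at: "Polynomial.coeff (at_p ?f) d = c"
      using lead by (simp add: coeff_at d_def)
    then have degf: "Polynomial.degree (at_p ?f) = d"
      using c deg_at[of ?f] le_degree[of "at_p ?f" d] unfolding d_def[symmetric] by (metis le_antisym)
    have "poly (at_p ?g) z = 0" if "poly (at_p ?f) z = 0" for z
      using that assms(2) by (simp add: poly_at eval_line_poly vanishing_ideal_def zero_locus_def)
    moreover have "at_p ?f \<noteq> 0" using lead_at c by auto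
    ultimately have "at_p ?f dvd at_p ?g ^ d"
      using nullstellensatz_univariate[of "at_p ?f" "at_p ?g"] unfolding degf by blast
    moreover have "at_p r = Polynomial.smult (c ^ e) (at_p ?g ^ d) - at_p ?f * at_p q"
    proof (rule poly_eq_poly_eq_iff[THEN iffD1], rule ext)
      fix z
      have "eval_poly (poly (Polynomial.smult (const_poly (c ^ e)) (?g ^ d)) (const_poly z)) p =
          eval_poly (poly (?f * q + r) (const_poly z)) p"
        by (simp only: div)
      then show "poly (at_p r) z = poly (Polynomial.smult (c ^ e) (at_p ?g ^ d) - at_p ?f * at_p q) z"
        by (simp add: poly_at eval_poly_add eval_poly_mult eval_poly_power)
    qed
    ultimately have "at_p ?f dvd at_p r" by (simp add: dvd_smult)
    moreover have "r = 0 \<or> Polynomial.degree (at_p r) < Polynomial.degree (at_p ?f)"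
      using r deg_at[of r] unfolding degf by linarith
    ultimately have "at_p r = 0"
      using dvd_imp_degree_le[of "at_p ?f" "at_p r"] at_0 by force
    then show "eval_poly (Polynomial.coeff r k) p = eval_poly (Polynomial.coeff 0 k) p"
      using coeff_at[of r k] by simp
  qed
  have "const_poly (c ^ e) * G ^ d = F * Polynomial.coeff q 0"
  proof -
    have "Polynomial.coeff (Polynomial.smult (const_poly (c ^ e)) (?g ^ d)) 0 = Polynomial.coeff (?f * q) 0"
      using div \<open>r = 0\<close> by simp
    then show ?thesis
      by (simp add: coeff_mult_0 coeff_0_power coeff_0_line_poly)
  qed
  then have "const_poly (inverse (c ^ e)) * (const_poly (c ^ e) * G ^ d) =
      F * (const_poly (inverse (c ^ e)) * Polynomial.coeff q 0)"
    by (metis mult.left_commute)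
  moreover have "const_poly (inverse (c ^ e)) * (const_poly (c ^ e) * G ^ d) =
      const_poly (inverse (c ^ e) * c ^ e) * G ^ d"
    by (simp only: const_poly_mult[symmetric] mult.assoc)
  moreover have "inverse (c ^ e) * c ^ e = 1" using c by simp
  ultimately have "G ^ d = F * (const_poly (inverse (c ^ e)) * Polynomial.coeff q 0)"
    by (simp only: const_poly_1 mult_1)
  then have "F dvd G ^ d" by (rule dvdI)
  then show ?thesis ..
qed

section \<open>The coordinate ring\<close>

lemma in_principal_ideal_iff_dvd:
  fixes F G :: "'s cpoly"
  shows "G \<in> PIdl\<^bsub>cpoly_ring\<^esub> F \<longleftrightarrow> F dvd G"
  by (auto simp: cgenideal_def ring_of_type_algebra_def dvd_def mult.commute)

lemma residue_class_iff: "H \<in> residue_class F G \<longleftrightarrow> F dvd H - G"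
proof -
  have "H \<in> residue_class F G \<longleftrightarrow> (\<exists>A\<in>PIdl\<^bsub>cpoly_ring\<^esub> F. H = A + G)"
    unfolding residue_class_def a_r_coset_def'
    by (auto simp: ring_of_type_algebra_def)
  also have "\<dots> \<longleftrightarrow> F dvd H - G"
    unfolding Bex_def in_principal_ideal_iff_dvd by (metis add_diff_cancel diff_add_cancel)
  finally show ?thesis .
qed

lemma residue_class_hom:
  fixes F :: "'s cpoly"
  shows "Ring.ring (coord_ring F)" "residue_class F \<in> Ring.ring_hom cpoly_ring (coord_ring F)"
    "carrier (coord_ring F) = range (residue_class F)"
    "\<zero>\<^bsub>coord_ring F\<^esub> = residue_class F 0"
proof -
  interpret R: cring "cpoly_ring :: 's cpoly ring"
    by (rule cring_from_type_algebra)
  have "F \<in> carrier cpoly_ring" by (simp add: ring_of_type_algebra_def)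
  then interpret I: ideal "PIdl\<^bsub>cpoly_ring\<^esub> F" cpoly_ring
    by (rule R.cgenideal_ideal)
  show "Ring.ring (coord_ring F)"
    unfolding coord_ring_def by (rule I.quotient_is_ring)
  have rc: "residue_class F = (+>\<^bsub>cpoly_ring\<^esub>) (PIdl\<^bsub>cpoly_ring\<^esub> F)"
    by (simp add: fun_eq_iff residue_class_def)
  show "residue_class F \<in> Ring.ring_hom cpoly_ring (coord_ring F)"
    unfolding coord_ring_def rc by (rule I.rcos_ring_hom)
  show "carrier (coord_ring F) = range (residue_class F)"
    unfolding coord_ring_def FactRing_def A_RCOSETS_def'
    by (auto simp: residue_class_def ring_of_type_algebra_def)
  have "\<zero>\<^bsub>coord_ring F\<^esub> = PIdl\<^bsub>cpoly_ring\<^esub> F"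
    by (simp add: coord_ring_def FactRing_def)
  then show "\<zero>\<^bsub>coord_ring F\<^esub> = residue_class F 0"
    by (auto simp: set_eq_iff residue_class_iff in_principal_ideal_iff_dvd)
qed

lemma residue_class_mult: "residue_class F A \<otimes>\<^bsub>coord_ring F\<^esub> residue_class F B = residue_class F (A * B)"
  and residue_class_add: "residue_class F A \<oplus>\<^bsub>coord_ring F\<^esub> residue_class F B = residue_class F (A + B)"
  and residue_class_one: "\<one>\<^bsub>coord_ring F\<^esub> = residue_class F 1"
  using ring_hom_mult[OF residue_class_hom(2), of A B F] ring_hom_add[OF residue_class_hom(2), of A B F]
    ring_hom_one[OF residue_class_hom(2)[of F]]
  by (simp_all add: ring_of_type_algebra_def)

lemma reduced_imp_radical:
  fixes F G :: "'s cpoly"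
  assumes "reduced_ring (coord_ring F)" "F dvd G ^ k"
  shows "F dvd G"
proof -
  have pow: "residue_class F G [^]\<^bsub>coord_ring F\<^esub> k = residue_class F (G ^ k)" for k :: nat
  proof (induction k)
    case (Suc k)
    then show ?case by (simp add: nat_pow_def residue_class_mult mult.commute)
  qed (simp add: nat_pow_def residue_class_one)
  have "residue_class F (G ^ k) = residue_class F 0"
    using assms(2) by (auto simp: set_eq_iff residue_class_iff dvd_diff_left_iff)
  then have "residue_class F G = residue_class F 0"
    using assms(1) pow[of k] unfolding reduced_ring_def residue_class_hom(3,4) by (metis rangeI)
  then have "G \<in> residue_class F 0"
    by (metis residue_class_iff diff_self dvd_0_right)
  then show ?thesis by (simp add: residue_class_iff)
qed

text \<open>
  Evaluation at a point of the hypersurface factors through the coordinate ring.  Its kernel is an ideal, so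
  it contains the ideal generated by the minors as soon as it contains the minors.
\<close>

lemma zero_set_in_jac_ideal:
  fixes F :: "'s::{finite,linorder} cpoly"
  shows "zero_set_in (zero_locus {F}) (jac_ideal n F) =
    {p \<in> zero_locus {F}. \<forall>G\<in>minors ((n + CARD('s) - 1) choose CARD('s)) (Jac n F). eval_poly G p = 0}"
    (is "_ = {p \<in> _. \<forall>G\<in>?S. _}")
proof -
  interpret Q: Ring.ring "coord_ring F" by (rule residue_class_hom(1))
  have gens: "residue_class F ` ?S \<subseteq> carrier (coord_ring F)"
    by (auto simp: residue_class_hom(3))
  have "(\<forall>C\<in>jac_ideal n F. \<forall>G\<in>C. eval_poly G p = 0) \<longleftrightarrow> (\<forall>G\<in>?S. eval_poly G p = 0)"
    if p: "p \<in> zero_locus {F}" for p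
  proof
    assume all: "\<forall>C\<in>jac_ideal n F. \<forall>G\<in>C. eval_poly G p = 0"
    show "\<forall>G\<in>?S. eval_poly G p = 0"
    proof
      fix G
      assume "G \<in> ?S"
      then have "residue_class F G \<in> jac_ideal n F"
        unfolding jac_ideal_def using Q.genideal_self[OF gens] by blast
      moreover have "G \<in> residue_class F G" by (simp add: residue_class_iff)
      ultimately show "eval_poly G p = 0" using all by blast
    qed
  next
    assume minors: "\<forall>G\<in>?S. eval_poly G p = 0"
    \<comment> \<open>evaluation at \<open>p\<close> on the quotient ring, through an arbitrary representative\<close>
    define h where "h C = eval_poly (SOME G. G \<in> C) p" for C :: "'s cpoly set"
    have same: "eval_poly H p = eval_poly G p" if H: "H \<in> residue_class F G" for H G
    proof -
      obtain A where "H - G = F * A" using H by (auto simp: residue_class_iff)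
      then have "eval_poly H p - eval_poly G p = 0"
        using p by (simp add: zero_locus_def eval_poly_mult flip: eval_poly_minus)
      then show ?thesis by simp
    qed
    have h: "h (residue_class F G) = eval_poly G p" for G
      unfolding h_def by (rule same, rule someI[of _ G]) (simp add: residue_class_iff)
    have "h \<in> Ring.ring_hom (coord_ring F) (ring_of_type_algebra :: complex ring)"
      by (rule ring_hom_memI)
         (auto simp: residue_class_hom(3) residue_class_mult residue_class_add residue_class_one h
           ring_of_type_algebra_def eval_poly_mult eval_poly_add)
    then have hom: "ring_hom_ring (coord_ring F) (ring_of_type_algebra :: complex ring) h"
      by (intro ring_hom_ringI2 residue_class_hom(1) ring_from_type_algebra)
    have "residue_class F ` ?S \<subseteq> a_kernel (coord_ring F) (ring_of_type_algebra :: complex ring) h"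
      using minors by (auto simp: a_kernel_def' residue_class_hom(3) h ring_of_type_algebra_def)
    then have "jac_ideal n F \<subseteq> a_kernel (coord_ring F) (ring_of_type_algebra :: complex ring) h"
      unfolding jac_ideal_def by (rule Q.genideal_minimal[OF ring_hom_ring.kernel_is_ideal[OF hom]])
    then have "\<exists>G. C = residue_class F G \<and> eval_poly G p = 0" if "C \<in> jac_ideal n F" for C
      using that h by (fastforce simp: a_kernel_def' residue_class_hom(3) ring_of_type_algebra_def)
    then show "\<forall>C\<in>jac_ideal n F. \<forall>G\<in>C. eval_poly G p = 0"
      using same by metis
  qed
  then show ?thesis unfolding zero_set_in_def by blast
qed

section \<open>Chains of irreducible algebraic sets\<close>

text \<open>
  Gaussian elimination: use one equation to eliminate one unknown.
\<close>

lemma underdetermined_system_solvable: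
  fixes a :: "'i \<Rightarrow> 'j \<Rightarrow> 'k::field"
  assumes "finite B" "finite A" "card B < card A"
  shows "\<exists>c. (\<exists>i\<in>A. c i \<noteq> 0) \<and> (\<forall>j\<in>B. (\<Sum>i\<in>A. c i * a i j) = 0)"
  using assms
proof (induction B arbitrary: A a rule: finite_induct)
  case empty
  then have "A \<noteq> {}" by auto
  then show ?case by (intro exI[of _ "\<lambda>_. 1"]) auto
next
  case (insert b B)
  show ?case
  proof (cases "\<forall>i\<in>A. a i b = 0")
    case True
    obtain c where "\<exists>i\<in>A. c i \<noteq> 0" "\<forall>j\<in>B. (\<Sum>i\<in>A. c i * a i j) = 0"
      using insert.IH[of A a] insert.prems insert.hyps by auto
    then show ?thesis using True by (intro exI[of _ c]) simp
  next
    case False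
    then obtain l where l: "l \<in> A" "a l b \<noteq> 0" by blast
    define a' where "a' i j = a i j - a i b / a l b * a l j" for i j
    have "card B < card (A - {l})"
      using insert l by simp
    then obtain c where c: "\<exists>i\<in>A - {l}. c i \<noteq> 0"
      "\<forall>j\<in>B. (\<Sum>i\<in>A - {l}. c i * a' i j) = 0"
      using insert.IH[of "A - {l}" a'] insert.prems by auto
    define c' where "c' = c(l := - (\<Sum>i\<in>A - {l}. c i * (a i b / a l b)))"
    have "(\<Sum>i\<in>A. c' i * a i j) = (\<Sum>i\<in>A - {l}. c i * a' i j)" for j
    proof -
      have "(\<Sum>i\<in>A. c' i * a i j) = c' l * a l j + (\<Sum>i\<in>A - {l}. c' i * a i j)"
        using l insert.prems by (simp add: sum.remove)
      also have "(\<Sum>i\<in>A - {l}. c' i * a i j) = (\<Sum>i\<in>A - {l}. c i * a i j)"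
        by (intro sum.cong) (auto simp: c'_def)
      finally show ?thesis
        by (simp add: c'_def a'_def sum_distrib_left sum_subtractf right_diff_distrib mult_ac)
    qed
    moreover have "a' i b = 0" for i using l by (simp add: a'_def)
    ultimately have "\<forall>j\<in>insert b B. (\<Sum>i\<in>A. c' i * a i j) = 0"
      using c(2) by simp
    moreover have "\<exists>i\<in>A. c' i \<noteq> 0"
      using c(1) by (auto simp: c'_def)
    ultimately show ?thesis by blast
  qed
qed

lemma irreducible_algebraic_setD:
  assumes "irreducible_algebraic_set Z" "\<And>p. p \<in> Z \<Longrightarrow> eval_poly F p * eval_poly G p = 0"
  shows "(\<forall>p\<in>Z. eval_poly F p = 0) \<or> (\<forall>p\<in>Z. eval_poly G p = 0)"
proof -
  obtain S where S: "Z = zero_locus S"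
    using assms(1) by (auto simp: irreducible_algebraic_set_def algebraic_set_def)
  have "Z = zero_locus (insert F S) \<union> zero_locus (insert G S)"
    using assms(2) by (auto simp: S zero_locus_def)
  then have "Z = zero_locus (insert F S) \<or> Z = zero_locus (insert G S)"
    using assms(1) unfolding irreducible_algebraic_set_def algebraic_set_def by blast
  then show ?thesis by (auto simp: zero_locus_def)
qed

text \<open>
  A closed set is cut out by its equations, so a point of a larger set violates one of them.
\<close>

lemma algebraic_set_separating_poly:
  assumes "algebraic_set Z" "Z \<subset> W"
  obtains f where "\<And>p. p \<in> Z \<Longrightarrow> eval_poly f p = 0" "\<exists>p\<in>W. eval_poly f p \<noteq> 0"
  using assms unfolding algebraic_set_def zero_locus_def by blast

text \<open>
  The functions \<open>f\<^sub>0, \<dots>, f\<^sub>k\<^sub>-\<^sub>1\<close> are algebraically independent on \<open>Z\<^sub>k\<close>.  A relation has the form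
  \<open>f\<^sub>k ^ m * (Q + f\<^sub>k * R) = 0\<close> on \<open>Z\<^sub>k\<^sub>+\<^sub>1\<close>, where \<open>Q\<close> is a nontrivial combination of monomials in \<open>f\<^sub>0, \<dots>, f\<^sub>k\<^sub>-\<^sub>1\<close>.
  By irreducibility the factor \<open>f\<^sub>k ^ m\<close> can be dropped, since \<open>f\<^sub>k\<close> does not vanish on \<open>Z\<^sub>k\<^sub>+\<^sub>1\<close>.  On the smaller
  set \<open>Z\<^sub>k\<close> the function \<open>f\<^sub>k\<close> vanishes, which leaves the relation \<open>Q = 0\<close> with one function less.
\<close>

lemma chain_functions_algebraically_independent:
  fixes Z :: "nat \<Rightarrow> (complex ^ 's::finite) set" and c :: "'a \<Rightarrow> complex" and e :: "'a \<Rightarrow> nat \<Rightarrow> nat"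
  assumes "\<And>i. i \<le> k \<Longrightarrow> irreducible_algebraic_set (Z i)"
    and "\<And>i. i < k \<Longrightarrow> Z i \<subseteq> Z (Suc i)"
    and "\<And>i p. i < k \<Longrightarrow> p \<in> Z i \<Longrightarrow> eval_poly (f i) p = 0"
    and "\<And>i. i < k \<Longrightarrow> \<exists>p\<in>Z (Suc i). eval_poly (f i) p \<noteq> 0"
    and "finite A" "inj_on (\<lambda>a. restrict (e a) {..<k}) A"
    and "\<And>p. p \<in> Z k \<Longrightarrow> (\<Sum>a\<in>A. c a * (\<Prod>i<k. eval_poly (f i) p ^ e a i)) = 0"
    and "a \<in> A"
  shows "c a = 0"
  using assms
proof (induction k arbitrary: A a)
  case 0
  obtain p where "p \<in> Z 0"
    using 0(1) by (auto simp: irreducible_algebraic_set_def)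
  moreover have "A = {a}" using 0 by (auto simp: inj_on_def)
  ultimately show ?case using 0(7)[of p] by simp
next
  case (Suc k)
  show ?case
  proof (rule ccontr)
    assume "c a \<noteq> 0"
    define A' where "A' = {a\<in>A. c a \<noteq> 0}"
    have A': "finite A'" "A' \<noteq> {}" "A' \<subseteq> A"
      using Suc.prems(5,8) \<open>c a \<noteq> 0\<close> by (auto simp: A'_def)
    define m where "m = Min ((\<lambda>a. e a k) ` A')"
    have m_le: "m \<le> e b k" if "b \<in> A'" for b
      using A' that by (simp add: m_def)
    have "m \<in> (\<lambda>a. e a k) ` A'"
      unfolding m_def using A' by (intro Min_in) auto
    then obtain b where b: "b \<in> A'" "e b k = m" by auto
    \<comment> \<open>the cofactor of \<open>f k ^ m\<close>, where \<open>m\<close> is the least exponent of \<open>f k\<close> that occurs\<close>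
    define R where "R = (\<Sum>a\<in>A'. const_poly (c a) * ((\<Prod>i<k. f i ^ e a i) * f k ^ (e a k - m)))"
    have "eval_poly (f k ^ m) p * eval_poly R p = 0" if "p \<in> Z (Suc k)" for p
    proof -
      have "(\<Sum>a\<in>A. c a * (\<Prod>i<Suc k. eval_poly (f i) p ^ e a i)) =
          (\<Sum>a\<in>A'. c a * (\<Prod>i<Suc k. eval_poly (f i) p ^ e a i))"
        unfolding A'_def by (rule sum.mono_neutral_right) (use Suc.prems(5) in auto)
      also have "\<dots> = eval_poly (f k ^ m) p * eval_poly R p"
        unfolding R_def eval_poly_sum sum_distrib_left
      proof (rule sum.cong)
        fix a assume "a \<in> A'"
        then have "eval_poly (f k) p ^ e a k = eval_poly (f k) p ^ m * eval_poly (f k) p ^ (e a k - m)"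
          using m_le[of a] by (simp flip: power_add)
        then show "c a * (\<Prod>i<Suc k. eval_poly (f i) p ^ e a i) = eval_poly (f k ^ m) p *
            eval_poly (const_poly (c a) * ((\<Prod>i<k. f i ^ e a i) * f k ^ (e a k - m))) p"
          by (simp only: prod.lessThan_Suc eval_poly_mult eval_poly_prod eval_poly_power
              eval_const_poly mult_ac)
      qed simp
      finally show ?thesis using Suc.prems(7)[OF that] by simp
    qed
    moreover have "\<not> (\<forall>p\<in>Z (Suc k). eval_poly (f k ^ m) p = 0)"
      using Suc.prems(4)[of k] unfolding eval_poly_power by (metis lessI power_not_zero)
    ultimately have R: "\<forall>p\<in>Z (Suc k). eval_poly R p = 0"
      using irreducible_algebraic_setD[OF Suc.prems(1)[of "Suc k"]] by blast
    define B where "B = {a\<in>A'. e a k = m}"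
    have "c b = 0"
    proof (rule Suc.IH)
      show "irreducible_algebraic_set (Z i)" if "i \<le> k" for i
        using Suc.prems(1)[of i] that by simp
      show "Z i \<subseteq> Z (Suc i)" if "i < k" for i
        using Suc.prems(2)[of i] that by simp
      show "eval_poly (f i) p = 0" if "i < k" "p \<in> Z i" for i p
        using Suc.prems(3)[of i p] that by simp
      show "\<exists>p\<in>Z (Suc i). eval_poly (f i) p \<noteq> 0" if "i < k" for i
        using Suc.prems(4)[of i] that by simp
      show "finite B" using A' by (simp add: B_def)
      show "b \<in> B" using b by (simp add: B_def)
      show "inj_on (\<lambda>a. restrict (e a) {..<k}) B"
      proof (rule inj_onI)
        fix x y
        assume xy: "x \<in> B" "y \<in> B" and eq: "restrict (e x) {..<k} = restrict (e y) {..<k}"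
        have "restrict (e x) {..<Suc k} = restrict (e y) {..<Suc k}"
        proof
          fix i show "restrict (e x) {..<Suc k} i = restrict (e y) {..<Suc k} i"
            using fun_cong[OF eq, of i] xy by (auto simp: B_def less_Suc_eq)
        qed
        then show "x = y"
          using inj_onD[OF Suc.prems(6), of x y] xy A' unfolding B_def by blast
      qed
      fix p assume p: "p \<in> Z k"
      then have "eval_poly R p = 0" "eval_poly (f k) p = 0"
        using R Suc.prems(2)[of k] Suc.prems(3)[of k] by auto
      moreover have "eval_poly R p = (\<Sum>a\<in>A'. if e a k = m then c a * (\<Prod>i<k. eval_poly (f i) p ^ e a i) else 0)"
        unfolding R_def eval_poly_sum
        using \<open>eval_poly (f k) p = 0\<close> m_le
        by (intro sum.cong) (auto simp: eval_poly_mult eval_poly_prod eval_poly_power zero_power_eq order.antisym)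
      ultimately show "(\<Sum>a\<in>B. c a * (\<Prod>i<k. eval_poly (f i) p ^ e a i)) = 0"
        unfolding B_def using A' by (simp add: sum.inter_filter)
    qed
    then show False using b by (simp add: A'_def)
  qed
qed

lemma keys_mi_deg_mult:
  assumes "\<And>m. m \<in> Poly_Mapping.keys F \<Longrightarrow> mi_deg m \<le> a" "\<And>m. m \<in> Poly_Mapping.keys G \<Longrightarrow> mi_deg m \<le> b"
    and "m \<in> Poly_Mapping.keys (F * G)"
  shows "mi_deg m \<le> a + b"
proof -
  obtain x y where xy: "m = x + y" "x \<in> Poly_Mapping.keys F" "y \<in> Poly_Mapping.keys G"
    using keys_mult[of F G] assms(3) by auto
  then show ?thesis using assms(1)[OF xy(2)] assms(2)[OF xy(3)] by (simp add: mi_deg_add)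
qed

lemma keys_mi_deg_power:
  assumes "\<And>m. m \<in> Poly_Mapping.keys F \<Longrightarrow> mi_deg m \<le> a" "m \<in> Poly_Mapping.keys (F ^ k)"
  shows "mi_deg m \<le> a * k"
  using assms(2)
proof (induction k arbitrary: m)
  case 0
  then show ?case by (simp add: mi_deg_def)
next
  case (Suc k)
  then show ?case
    using keys_mi_deg_mult[OF assms(1), where G = "F ^ k" and b = "a * k" and m = m] by simp
qed

lemma keys_mi_deg_prod:
  assumes "finite I" "\<And>i m. i \<in> I \<Longrightarrow> m \<in> Poly_Mapping.keys (f i) \<Longrightarrow> mi_deg m \<le> a i"
    and "m \<in> Poly_Mapping.keys (\<Prod>i\<in>I. f i)"
  shows "mi_deg m \<le> sum a I"
  using assms
proof (induction I arbitrary: m rule: finite_induct)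
  case empty
  then show ?case by (simp add: mi_deg_def)
next
  case (insert j I)
  then show ?case
    using keys_mi_deg_mult[of "f j" "a j" "prod f I" "sum a I" m] by simp
qed

lemma card_mi_deg_le_bound: "card {m :: 's::finite mindex. mi_deg m \<le> K} \<le> (K + 1) ^ CARD('s)"
proof -
  let ?A = "{m :: 's mindex. mi_deg m \<le> K}"
  have "Poly_Mapping.lookup m i \<le> mi_deg m" for m :: "'s mindex" and i
    unfolding mi_deg_def by (rule member_le_sum) auto
  then have "Poly_Mapping.lookup ` ?A \<subseteq> UNIV \<rightarrow>\<^sub>E {..K}"
    using le_trans by (fastforce simp: PiE_def extensional_def)
  then have "card (Poly_Mapping.lookup ` ?A) \<le> card ((UNIV :: 's set) \<rightarrow>\<^sub>E {..K})"
    by (intro card_mono finite_PiE) auto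
  moreover have "inj_on Poly_Mapping.lookup ?A"
    by (auto intro!: inj_onI poly_mapping_eqI)
  ultimately show ?thesis by (simp add: card_image card_PiE)
qed

text \<open>
  More polynomials than variables are algebraically dependent.  The monomials in \<open>f\<^sub>0, \<dots>, f\<^sub>k\<^sub>-\<^sub>1\<close> with exponents
  at most \<open>D\<close> number \<open>(D + 1) ^ k\<close>, while they lie in a space of polynomials whose dimension grows
  only like \<open>D ^ s\<close>; for \<open>k > s\<close> and large \<open>D\<close> they are linearly dependent.
\<close>

lemma algebraically_dependent:
  fixes f :: "nat \<Rightarrow> 's::finite cpoly"
  assumes "k > CARD('s)"
  shows "\<exists>A c. finite A \<and> A \<subseteq> extensional {..<k} \<and> (\<exists>e\<in>A. c e \<noteq> 0) \<and>
    (\<forall>p. (\<Sum>e\<in>A. c e * (\<Prod>i<k. eval_poly (f i) p ^ e i)) = 0)"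
proof -
  define d where "d = Max (insert 0 (mi_deg ` (\<Union>i<k. Poly_Mapping.keys (f i))))"
  have d: "mi_deg m \<le> d" if "i < k" "m \<in> Poly_Mapping.keys (f i)" for i m
    unfolding d_def using that by (intro Max_ge) auto
  define s where "s = CARD('s)"
  \<comment> \<open>a choice for which \<open>(k d + 1) ^ s * (D + 1) ^ s < (D + 1) ^ (s + 1)\<close>\<close>
  define D where "D = (k * d + 1) ^ s"
  define K where "K = k * (d * D)"
  define A where "A = {..<k} \<rightarrow>\<^sub>E {..D}"
  define B where "B = {m :: 's mindex. mi_deg m \<le> K}"
  have fin: "finite A" "finite B"
    by (auto simp: A_def B_def finite_mi_deg_le intro!: finite_PiE)
  have "card B \<le> (K + 1) ^ s"
    unfolding B_def s_def by (rule card_mi_deg_le_bound)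
  also have "\<dots> \<le> ((k * d + 1) * (D + 1)) ^ s"
    by (rule power_mono) (simp_all add: K_def algebra_simps)
  also have "\<dots> = D * (D + 1) ^ s"
    by (simp only: power_mult_distrib D_def[symmetric])
  also have "\<dots> < (D + 1) ^ Suc s"
    by simp
  also have "\<dots> \<le> (D + 1) ^ k"
    using assms by (intro power_increasing) (auto simp: s_def)
  also have "\<dots> = card A"
    by (simp add: A_def card_PiE)
  finally have "card B < card A" .
  define g where "g e = (\<Prod>i<k. f i ^ e i)" for e
  have keys: "Poly_Mapping.keys (g e) \<subseteq> B" if "e \<in> A" for e
  proof
    fix m assume m: "m \<in> Poly_Mapping.keys (g e)"
    have "mi_deg m \<le> (\<Sum>i<k. d * e i)"
      using m unfolding g_def
      by (rule keys_mi_deg_prod[rotated 2]) (auto intro: keys_mi_deg_power d)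
    also have "\<dots> \<le> (\<Sum>i<k. d * D)"
      using that by (intro sum_mono mult_left_mono) (auto simp: A_def)
    finally show "m \<in> B" by (simp add: B_def K_def)
  qed
  obtain c where c: "\<exists>e\<in>A. c e \<noteq> 0" "\<forall>m\<in>B. (\<Sum>e\<in>A. c e * Poly_Mapping.lookup (g e) m) = 0"
    using underdetermined_system_solvable[OF fin(2,1) \<open>card B < card A\<close>, of "\<lambda>e. Poly_Mapping.lookup (g e)"]
    by blast
  show ?thesis
  proof (intro exI conjI allI)
    fix p
    have "(\<Sum>e\<in>A. c e * (\<Prod>i<k. eval_poly (f i) p ^ e i)) = (\<Sum>e\<in>A. c e * eval_poly (g e) p)"
      by (simp add: g_def eval_poly_prod eval_poly_power)
    also have "\<dots> = (\<Sum>e\<in>A. \<Sum>m\<in>B. c e * Poly_Mapping.lookup (g e) m * mono_val p m)"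
      by (intro sum.cong) (simp_all add: eval_poly_superset[OF fin(2) keys] sum_distrib_left mult.assoc)
    also have "\<dots> = (\<Sum>m\<in>B. (\<Sum>e\<in>A. c e * Poly_Mapping.lookup (g e) m) * mono_val p m)"
      by (subst sum.swap) (simp add: sum_distrib_right)
    also have "\<dots> = 0" using c(2) by simp
    finally show "(\<Sum>e\<in>A. c e * (\<Prod>i<k. eval_poly (f i) p ^ e i)) = 0" .
  qed (use fin c in \<open>auto simp: A_def PiE_def\<close>)
qed

theorem irreducible_chain_length_le:
  fixes Z :: "nat \<Rightarrow> (complex ^ 's::finite) set"
  assumes irr: "\<And>i. i \<le> k \<Longrightarrow> irreducible_algebraic_set (Z i)"
    and strict: "\<And>i. i < k \<Longrightarrow> Z i \<subset> Z (Suc i)"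
  shows "k \<le> CARD('s)"
proof (rule ccontr)
  assume "\<not> k \<le> CARD('s)"
  then have k: "k > CARD('s)" by simp
  have "\<exists>f. (\<forall>p\<in>Z i. eval_poly f p = 0) \<and> (\<exists>p\<in>Z (Suc i). eval_poly f p \<noteq> 0)" if "i < k" for i
  proof -
    have "algebraic_set (Z i)"
      using irr[of i] that by (simp add: irreducible_algebraic_set_def)
    from algebraic_set_separating_poly[OF this strict[OF that]] show ?thesis by metis
  qed
  then obtain f where f: "\<And>i p. i < k \<Longrightarrow> p \<in> Z i \<Longrightarrow> eval_poly (f i) p = 0"
    "\<And>i. i < k \<Longrightarrow> \<exists>p\<in>Z (Suc i). eval_poly (f i) p \<noteq> 0"
    by metis
  obtain A c where A: "finite A" "A \<subseteq> extensional {..<k}" "\<exists>e\<in>A. c e \<noteq> 0"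
    "\<And>p. (\<Sum>e\<in>A. c e * (\<Prod>i<k. eval_poly (f i) p ^ e i)) = 0"
    using algebraically_dependent[OF k, of f] by blast
  have inj: "inj_on (\<lambda>e. restrict e {..<k}) A"
    using A(2) by (auto intro!: inj_onI simp: extensional_restrict subset_iff)
  have "c e = 0" if "e \<in> A" for e
    by (rule chain_functions_algebraically_independent[where Z = Z and e = "\<lambda>e. e",
          OF irr psubset_imp_subset[OF strict] f A(1) inj A(4) that])
  then show False using A(3) by blast
qed

section \<open>Irreducible Zariski closures and smooth points\<close>

lemma holomorphic_on_eval_poly:
  assumes "\<And>i. (\<lambda>z. vec_nth (h z) i) holomorphic_on D"
  shows "(\<lambda>z. eval_poly F (h z)) holomorphic_on D"
  unfolding eval_poly_def by (intro holomorphic_intros assms)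

text \<open>
  If \<open>f * g\<close> vanishes on \<open>W\<close> but \<open>f\<close> does not vanish at \<open>a\<close> and \<open>g\<close> does not vanish at \<open>b\<close>, join \<open>a\<close> and \<open>b\<close> by a
  holomorphic curve in \<open>W\<close>.  On a connected domain a product of holomorphic functions is zero only if one factor is,
  by the identity theorem.  Curves in one variable suffice, so the identity theorem in one complex variable
  is enough.
\<close>

lemma irreducible_zariski_closure:
  fixes W :: "(complex ^ 's::finite) set"
  assumes "W \<noteq> {}"
    and curve: "\<And>a b. a \<in> W \<Longrightarrow> b \<in> W \<Longrightarrow> \<exists>D h. open D \<and> connected D \<and>
      (\<forall>i. (\<lambda>z. vec_nth (h z) i) holomorphic_on D) \<and> h ` D \<subseteq> W \<and> a \<in> h ` D \<and> b \<in> h ` D"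
  shows "irreducible_algebraic_set (zero_locus (vanishing_ideal W))"
proof -
  let ?Z = "zero_locus (vanishing_ideal W)"
  have sub: "W \<subseteq> ?Z"
    by (auto simp: zero_locus_def vanishing_ideal_def)
  have closure: "?Z \<subseteq> zero_locus S" if "W \<subseteq> zero_locus S" for S
    using that by (auto simp: zero_locus_def vanishing_ideal_def)
  have "?Z = A \<or> ?Z = B" if alg: "algebraic_set A" "algebraic_set B" and un: "?Z = A \<union> B" for A B
  proof (rule ccontr)
    assume ne: "\<not> (?Z = A \<or> ?Z = B)"
    obtain S T where S: "A = zero_locus S" and T: "B = zero_locus T"
      using alg by (auto simp: algebraic_set_def)
    have "\<not> W \<subseteq> A" "\<not> W \<subseteq> B"
      using closure[of S] closure[of T] S T un ne by blast+
    then obtain a b f g where ab: "a \<in> W" "b \<in> W" and f: "f \<in> S" "eval_poly f a \<noteq> 0"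
      and g: "g \<in> T" "eval_poly g b \<noteq> 0"
      by (auto simp: S T zero_locus_def)
    obtain D h where D: "open D" "connected D" and hol: "\<And>i. (\<lambda>z. vec_nth (h z) i) holomorphic_on D"
      and h: "h ` D \<subseteq> W" "a \<in> h ` D" "b \<in> h ` D"
      using curve[OF ab] by metis
    obtain z w where z: "z \<in> D" "a = h z" and w: "w \<in> D" "b = h w"
      using h by auto
    let ?f = "\<lambda>z. eval_poly f (h z)" and ?g = "\<lambda>z. eval_poly g (h z)"
    have holf: "?f holomorphic_on D" and holg: "?g holomorphic_on D"
      by (intro holomorphic_on_eval_poly hol)+
    have zero: "?f z = 0 \<or> ?g z = 0" if "z \<in> D" for z
    proof -
      have "h z \<in> A \<union> B" using that h sub un by auto
      then show ?thesis using f g by (auto simp: S T zero_locus_def)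
    qed
    let ?D' = "D \<inter> ?f -` (- {0})"
    have "open ?D'"
      by (intro continuous_open_preimage holomorphic_on_imp_continuous_on holf D) auto
    then have "?g w = 0"
    proof (rule analytic_continuation_open[where f = ?g and g = "\<lambda>_. 0"])
      show "?D' \<noteq> {}" using z f by auto
      show "?g x = 0" if "x \<in> ?D'" for x
        using zero[of x] that by auto
    qed (use D w holg in auto)
    then show False using w g by simp
  qed
  then show ?thesis
    using assms(1) sub unfolding irreducible_algebraic_set_def algebraic_set_def by blast
qed

lemma irreducible_UNIV: "irreducible_algebraic_set (UNIV :: (complex ^ 's::finite) set)"
proof -
  have "irreducible_algebraic_set (zero_locus (vanishing_ideal (UNIV :: (complex ^ 's) set)))"
  proof (rule irreducible_zariski_closure)
    fix a b :: "complex ^ 's"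
    let ?h = "\<lambda>z. a + z *s (b - a)"
    have "a \<in> range ?h" "b \<in> range ?h"
      by (rule image_eqI[of _ _ 0], simp, simp, rule image_eqI[of _ _ 1], simp, simp)
    moreover have "(\<lambda>z. vec_nth (?h z) i) holomorphic_on UNIV" for i
      by (simp, intro holomorphic_intros)
    ultimately show "\<exists>D h. open D \<and> connected D \<and> (\<forall>i. (\<lambda>z. vec_nth (h z) i) holomorphic_on D) \<and>
        h ` D \<subseteq> UNIV \<and> a \<in> h ` D \<and> b \<in> h ` D"
      by (intro exI[of _ UNIV] exI[of _ ?h]) auto
  qed simp
  moreover have "zero_locus (vanishing_ideal (UNIV :: (complex ^ 's) set)) = UNIV"
    by (auto simp: zero_locus_def vanishing_ideal_def)
  ultimately show ?thesis by simp
qed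

text \<open>
  A chain inside a proper hypersurface can be extended by the whole space.
\<close>

theorem irreducible_chain_in_hypersurface:
  fixes Z :: "nat \<Rightarrow> (complex ^ 's::finite) set"
  assumes irr: "\<And>i. i \<le> k \<Longrightarrow> irreducible_algebraic_set (Z i)"
    and strict: "\<And>i. i < k \<Longrightarrow> Z i \<subset> Z (Suc i)"
    and "Z k \<subseteq> zero_locus {F}" "F \<noteq> 0"
  shows "k < CARD('s)"
proof -
  obtain p where "eval_poly F p \<noteq> 0"
    using eval_poly_eq_0_imp_eq_0 assms(4) by blast
  then have proper: "Z k \<subset> UNIV"
    using assms(3) by (auto simp: zero_locus_def)
  have "Suc k \<le> CARD('s)"
  proof (rule irreducible_chain_length_le[where Z = "Z(Suc k := UNIV)"])
    show "irreducible_algebraic_set ((Z(Suc k := UNIV)) i)" if "i \<le> Suc k" for i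
      using irr[of i] irreducible_UNIV that by auto
    show "(Z(Suc k := UNIV)) i \<subset> (Z(Suc k := UNIV)) (Suc i)" if "i < Suc k" for i
      using strict[of i] proper that by (cases "i = k") auto
  qed
  then show ?thesis by simp
qed

lemma inv_complex_linear:
  fixes L :: "complex ^ 's \<Rightarrow> complex ^ 's"
  assumes "bij L" "\<And>c v. L (c *s v) = c *s L v"
  shows "inv_into UNIV L (c *s v) = c *s inv_into UNIV L v"
  using assms by (metis bij_inv_eq_iff)

text \<open>
  Near a point where the \<open>i\<close>-th partial derivative is nonzero, replacing the \<open>i\<close>-th coordinate by the value of
  \<open>F\<close> is a local change of coordinates \<open>f\<close> that sends \<open>p\<close> to \<open>q\<close>.  Its inverse \<open>g\<close> parametrizes the level sets
  of \<open>F\<close>, and the hypersurface is the image of the slice where the \<open>i\<close>-th coordinate is \<open>0\<close>.  The real inverse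
  function theorem is enough: the differential of \<open>f\<close> is complex linear, hence so is that of \<open>g\<close>, which makes \<open>g\<close>
  holomorphic on complex lines.
\<close>

lemma hypersurface_local_parametrization:
  fixes F :: "'s::finite cpoly"
  assumes Fp: "eval_poly F p = 0" and grad: "eval_poly (partial_deriv i F) p \<noteq> 0"
  defines "q \<equiv> (\<chi> j. if j = i then 0 else vec_nth p j)"
  shows "\<exists>r>0. \<exists>g. g q = p \<and> (\<forall>y\<in>ball q r. eval_poly F (g y) = vec_nth y i) \<and>
    (\<forall>y\<in>ball q r. \<forall>j. j \<noteq> i \<longrightarrow> vec_nth (g y) j = vec_nth y j) \<and>
    (\<forall>a w j. (\<lambda>z. vec_nth (g (a + z *s w)) j) holomorphic_on {z. a + z *s w \<in> ball q r})"
proof -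
  define dF where "dF x v = (\<Sum>j\<in>UNIV. eval_poly (partial_deriv j F) x * vec_nth v j)" for x v
  define f where "f x = x + axis i (eval_poly F x - vec_nth x i)" for x
  define L where "L x v = v + axis i (dF x v - vec_nth v i)" for x v
  have axis: "bounded_linear (\<lambda>c :: complex. axis i c :: complex ^ 's)"
    unfolding linear_conv_bounded_linear[symmetric]
    by (rule linearI) (auto simp: axis_def Finite_Cartesian_Product.vec_eq_iff)
  have f_nth: "vec_nth (f x) j = (if j = i then eval_poly F x else vec_nth x j)" for x j
    by (simp add: f_def axis_def)
  have L_nth: "vec_nth (L x v) j = (if j = i then dF x v else vec_nth v j)" for x v j
    by (simp add: L_def axis_def)
  have derf: "(f has_derivative L x) (at x)" for x
    unfolding f_def L_def dF_def
    by (intro has_derivative_add has_derivative_ident bounded_linear.has_derivative[OF axis]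
        has_derivative_diff has_derivative_eval_poly bounded_linear_imp_has_derivative bounded_linear_vec_nth)
  then have bl: "bounded_linear (L x)" for x
    by (rule has_derivative_bounded_linear)
  define f' where "f' x = Blinfun (L x)" for x
  have f': "blinfun_apply (f' x) = L x" for x
    by (simp add: f'_def bounded_linear_Blinfun_apply bl)
  have L_smult: "L x (c *s v) = c *s L x v" for x c v
    by (simp add: Finite_Cartesian_Product.vec_eq_iff L_nth dF_def sum_distrib_left mult_ac)
  let ?a = "eval_poly (partial_deriv i F) p"
  \<comment> \<open>the inverse of the differential of \<open>f\<close> at \<open>p\<close>\<close>
  define M where "M v = v + axis i ((vec_nth v i - dF p v) / ?a)" for v
  have dF_axis: "dF p (v + axis i c) = dF p v + ?a * c" for v c
    by (simp add: dF_def distrib_left sum.distrib)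
       (simp add: axis_def if_distrib[of "\<lambda>x. _ * x"] cong: if_cong)
  have left_inv: "M (L p v) = v" for v
    using grad by (simp add: M_def L_def dF_axis) (simp add: axis_def Finite_Cartesian_Product.vec_eq_iff)
  have "bounded_linear (dF p)"
    unfolding dF_def using has_derivative_bounded_linear[OF has_derivative_eval_poly] .
  then have "bounded_linear M"
    unfolding M_def
    by (intro bounded_linear_add bounded_linear_ident bounded_linear_compose[OF axis]
        bounded_linear_compose[OF bounded_linear_divide] bounded_linear_sub bounded_linear_vec_nth)
  then have invf: "Blinfun M o\<^sub>L f' p = id_blinfun"
    by (intro blinfun_eqI) (simp add: f' bounded_linear_Blinfun_apply left_inv)
  have contf: "continuous_on UNIV f'"
    by (rule continuous_on_blinfun_componentwise)
       (simp add: f' L_def dF_def, intro continuous_intros continuous_on_eval_poly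
         bounded_linear.continuous_on[OF axis])
  obtain U V g g' where UV: "open U" "p \<in> U" "open V" "f p \<in> V"
    and hom: "homeomorphism U V f g"
    and derg: "\<And>y. y \<in> V \<Longrightarrow> (g has_derivative (g' y)) (at y)"
    and g': "\<And>y. y \<in> V \<Longrightarrow> g' y = inv_into UNIV (blinfun_apply (f' (g y)))"
    and bij: "\<And>y. y \<in> V \<Longrightarrow> bij (blinfun_apply (f' (g y)))"
    by (rule inverse_function_theorem[of UNIV f f' p "Blinfun M"])
       (use derf contf invf in \<open>auto simp: f'\<close>)
  have q: "f p = q"
    by (simp add: Finite_Cartesian_Product.vec_eq_iff f_nth q_def Fp)
  obtain r where r: "r > 0" "ball q r \<subseteq> V"
    using UV q open_contains_ball by metis
  have fg: "f (g y) = y" if "y \<in> ball q r" for y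
    using hom that r by (auto simp: homeomorphism_def)
  have g'_smult: "g' y (c *s v) = c *s g' y v" if "y \<in> V" for y c v
    unfolding g'[OF that] by (rule inv_complex_linear[OF bij[OF that]]) (simp add: f' L_smult)
  show ?thesis
  proof (intro exI[of _ r] exI[of _ g] conjI ballI allI impI)
    show "g q = p"
      using hom UV q by (auto simp: homeomorphism_def)
    show "eval_poly F (g y) = vec_nth y i" if "y \<in> ball q r" for y
      using f_nth[of "g y" i] fg[OF that] by simp
    show "vec_nth (g y) j = vec_nth y j" if "y \<in> ball q r" "j \<noteq> i" for y j
      using f_nth[of "g y" j] fg[OF that(1)] that by simp
    show "(\<lambda>z. vec_nth (g (a + z *s w)) j) holomorphic_on {z. a + z *s w \<in> ball q r}" for a w j
    proof (rule holomorphic_onI)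
      fix z assume "z \<in> {z. a + z *s w \<in> ball q r}"
      then have V: "a + z *s w \<in> V" using r by auto
      have "bounded_linear (\<lambda>z :: complex. z *s w)"
        unfolding linear_conv_bounded_linear[symmetric]
        by (rule linearI) (auto simp: Finite_Cartesian_Product.vec_eq_iff algebra_simps)
      then have "((\<lambda>z. a + z *s w) has_derivative (\<lambda>h. 0 + h *s w)) (at z)"
        by (intro has_derivative_add has_derivative_const bounded_linear_imp_has_derivative)
      from has_derivative_compose[OF this derg[OF V]]
      have "((\<lambda>z. g (a + z *s w)) has_derivative (\<lambda>h. g' (a + z *s w) (0 + h *s w))) (at z)" .
      from bounded_linear.has_derivative[OF bounded_linear_vec_nth[of j] this]
      have "((\<lambda>z. vec_nth (g (a + z *s w)) j) has_derivative
          (\<lambda>h. vec_nth (g' (a + z *s w) w) j * h)) (at z)"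
        by (simp add: g'_smult[OF V] mult.commute)
      then have "((\<lambda>z. vec_nth (g (a + z *s w)) j) has_field_derivative
          vec_nth (g' (a + z *s w) w) j) (at z)"
        by (simp add: has_field_derivative_def)
      then show "(\<lambda>z. vec_nth (g (a + z *s w)) j) field_differentiable
          at z within {z. a + z *s w \<in> ball q r}"
        using field_differentiable_at_within field_differentiable_def by blast
    qed
  qed (rule r(1))
qed

lemma norm_axis_eq: "norm (axis t c :: 'a::real_normed_vector ^ 's::finite) = norm c"
proof -
  have "(\<Sum>j\<in>UNIV. (norm (vec_nth (axis t c :: 'a ^ 's) j))\<^sup>2) = (\<Sum>j\<in>UNIV. if j = t then (norm c)\<^sup>2 else 0)"
    by (rule sum.cong) (auto simp: axis_def)
  then show ?thesis by (simp add: norm_vec_def L2_set_def)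
qed

text \<open>
  The members of the chain are the Zariski closures of slices of the local parametrization, in which only
  the first \<open>k\<close> of the coordinates other than \<open>i\<close> may move.  Slices are convex, so complex lines join their points and the
  closures are irreducible.  The inclusions are strict because the coordinate that is
  released in a step is constant on the smaller closure.
\<close>

theorem irreducible_chain_through_smooth_point:
  fixes F :: "'s::finite cpoly"
  assumes Fp: "eval_poly F p = 0" and grad: "eval_poly (partial_deriv i F) p \<noteq> 0"
  shows "\<exists>Z. (\<forall>k. irreducible_algebraic_set (Z k) \<and> Z k \<subseteq> zero_locus {F} \<and> p \<in> Z k) \<and>
    (\<forall>k. Suc k < CARD('s) \<longrightarrow> Z k \<subset> Z (Suc k))"
proof -
  define q where "q = (\<chi> j. if j = i then 0 else vec_nth p j)"
  obtain r g where r: "r > 0" and gq: "g q = p"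
    and Fg: "\<And>y. y \<in> ball q r \<Longrightarrow> eval_poly F (g y) = vec_nth y i"
    and g_nth: "\<And>y j. y \<in> ball q r \<Longrightarrow> j \<noteq> i \<Longrightarrow> vec_nth (g y) j = vec_nth y j"
    and hol: "\<And>a w j. (\<lambda>z. vec_nth (g (a + z *s w)) j) holomorphic_on {z. a + z *s w \<in> ball q r}"
    using hypersurface_local_parametrization[OF assms, folded q_def] by blast
  obtain js where js: "set js = UNIV - {i}" "distinct js"
    using finite_distinct_list[of "UNIV - {i}"] by auto
  then have len: "length js = CARD('s) - 1"
    using distinct_card[of js] by (simp add: card_Diff_singleton)
  define B where "B k = {y \<in> ball q r. \<forall>j. j \<notin> set (take k js) \<longrightarrow> vec_nth y j = vec_nth q j}" for k
  define Z where "Z k = zero_locus (vanishing_ideal (g ` B k))" for k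
  have sub: "g ` B k \<subseteq> Z k" for k
    by (auto simp: Z_def zero_locus_def vanishing_ideal_def)
  have qB: "q \<in> B k" for k using r by (simp add: B_def)
  have B_i: "vec_nth y i = 0" if "y \<in> B k" for y k
  proof -
    have "i \<notin> set (take k js)" using js set_take_subset[of k js] by auto
    then show ?thesis using that by (simp add: B_def q_def)
  qed
  have "irreducible_algebraic_set (Z k)" for k
    unfolding Z_def
  proof (rule irreducible_zariski_closure)
    show "g ` B k \<noteq> {}" using qB by auto
    fix a' b' assume "a' \<in> g ` B k" "b' \<in> g ` B k"
    then obtain a b where ab: "a \<in> B k" "b \<in> B k" "a' = g a" "b' = g b" by auto
    define l where "l z = a + z *s (b - a)" for z
    define D where "D = {z. l z \<in> ball q r}"
    \<comment> \<open>real-affine form in the real and imaginary part of \<open>z\<close>: it gives continuity of \<open>l\<close> and convexity of \<open>D\<close>\<close>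
    have l_lin: "l z = a + Re z *\<^sub>R (b - a) + Im z *\<^sub>R (\<i> *s (b - a))" for z
      unfolding l_def Finite_Cartesian_Product.vec_eq_iff
      by (simp add: complex_eq_iff algebra_simps)
    have "continuous_on UNIV l"
      unfolding l_lin[abs_def] by (intro continuous_intros)
    then have "open D"
      unfolding D_def using continuous_open_vimage[of "ball q r" l]
      by (simp add: vimage_def continuous_on_eq_continuous_at)
    moreover have "convex D"
      unfolding convex_alt D_def
    proof (intro ballI allI impI, simp only: mem_Collect_eq)
      fix x y :: complex and u :: real
      assume xy: "l x \<in> ball q r" "l y \<in> ball q r" "0 \<le> u \<and> u \<le> 1"
      have "l ((1 - u) *\<^sub>R x + u *\<^sub>R y) = (1 - u) *\<^sub>R l x + u *\<^sub>R l y"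
        by (simp add: l_lin algebra_simps)
      then show "l ((1 - u) *\<^sub>R x + u *\<^sub>R y) \<in> ball q r"
        using convex_ball[of q r] xy unfolding convex_alt by metis
    qed
    moreover have "(\<lambda>z. vec_nth (g (l z)) j) holomorphic_on D" for j
      using hol[of a "b - a" j] by (simp add: l_def D_def)
    moreover have "(\<lambda>z. g (l z)) ` D \<subseteq> g ` B k"
      using ab by (auto simp: D_def B_def l_def)
    moreover have "0 \<in> D" "1 \<in> D" "l 0 = a" "l 1 = b"
      using ab by (auto simp: D_def B_def l_def)
    ultimately show "\<exists>D h. open D \<and> connected D \<and>
        (\<forall>i. (\<lambda>z. vec_nth (h z) i) holomorphic_on D) \<and> h ` D \<subseteq> g ` B k \<and> a' \<in> h ` D \<and> b' \<in> h ` D"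
      using ab by (intro exI[of _ D] exI[of _ "\<lambda>z. g (l z)"]) (auto intro: convex_connected)
  qed
  moreover have "Z k \<subseteq> zero_locus {F}" for k
  proof -
    have "F \<in> vanishing_ideal (g ` B k)"
      using Fg B_i by (auto simp: vanishing_ideal_def B_def)
    then show ?thesis by (auto simp: Z_def zero_locus_def)
  qed
  moreover have "p \<in> Z k" for k
    using sub qB gq by blast
  moreover have "Z k \<subset> Z (Suc k)" if k: "Suc k < CARD('s)" for k
  proof -
    have kl: "k < length js" using k len by simp
    define t where "t = js ! k"
    have t: "t \<noteq> i" "t \<notin> set (take k js)"
      using js kl nth_mem[OF kl] by (auto simp: t_def in_set_conv_nth nth_eq_iff_index_eq)
    have take: "set (take (Suc k) js) = insert t (set (take k js))"
      using kl by (simp add: take_Suc_conv_app_nth t_def)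
    have "B k \<subseteq> B (Suc k)" unfolding B_def take by auto
    then have "Z k \<subseteq> Z (Suc k)"
      unfolding Z_def zero_locus_def vanishing_ideal_def by blast
    moreover have "Z k \<noteq> Z (Suc k)"
    proof
      assume eq: "Z k = Z (Suc k)"
      \<comment> \<open>vanishes on the slice with coordinate \<open>t\<close> frozen, but not on the next one\<close>
      define H where "H = var_poly t - const_poly (vec_nth q t)"
      have "H \<in> vanishing_ideal (g ` B k)"
        using t g_nth by (auto simp: vanishing_ideal_def H_def eval_poly_minus B_def)
      then have vanish: "\<forall>x\<in>Z k. eval_poly H x = 0"
        by (auto simp: Z_def zero_locus_def)
      define y where "y = q + axis t (of_real (r / 2))"
      have "dist q y = norm (axis t (of_real (r / 2)) :: complex ^ 's)"
        by (simp add: y_def dist_norm)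
      also have "\<dots> = r / 2" using r by (simp add: norm_axis_eq)
      finally have y: "y \<in> ball q r" using r by simp
      then have "y \<in> B (Suc k)"
        unfolding B_def take by (auto simp: y_def axis_def)
      then have "eval_poly H (g y) = 0"
        using vanish sub eq by blast
      then have "vec_nth y t = vec_nth q t"
        using g_nth[OF y t(1)] by (simp add: H_def eval_poly_minus)
      then show False using r by (simp add: y_def axis_def)
    qed
    ultimately show ?thesis by blast
  qed
  ultimately show ?thesis by blast
qed

section \<open>The singular locus of a hypersurface\<close>

text \<open>
  If \<open>G = F * H\<close>, then at a zero of \<open>F\<close> the differential of \<open>G\<close> is \<open>H p\<close> times the differential of \<open>F\<close>.
\<close>

lemma tangent_space_hypersurface:
  fixes F :: "'s::{finite,linorder} cpoly"
  assumes "\<nexists>c. F = const_poly c" "reduced_ring (coord_ring F)" "p \<in> zero_locus {F}"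
  shows "tangent_space (zero_locus {F}) p =
    {v. (\<Sum>i\<in>UNIV. eval_poly (partial_deriv i F) p * vec_nth v i) = 0}"
proof (intro equalityI subsetI)
  fix v assume "v \<in> tangent_space (zero_locus {F}) p"
  then show "v \<in> {v. (\<Sum>i\<in>UNIV. eval_poly (partial_deriv i F) p * vec_nth v i) = 0}"
    by (auto simp: tangent_space_def vanishing_ideal_def zero_locus_def)
next
  fix v assume v: "v \<in> {v. (\<Sum>i\<in>UNIV. eval_poly (partial_deriv i F) p * vec_nth v i) = 0}"
  have "(\<Sum>i\<in>UNIV. eval_poly (partial_deriv i G) p * vec_nth v i) = 0"
    if G: "G \<in> vanishing_ideal (zero_locus {F})" for G
  proof -
    obtain k where "F dvd G ^ k"
      using hypersurface_nullstellensatz[OF assms(1) G] by blast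
    then obtain H where "G = F * H"
      using reduced_imp_radical[OF assms(2)] by (blast elim: dvdE)
    moreover have "eval_poly F p = 0"
      using assms(3) by (simp add: zero_locus_def)
    ultimately have "(\<Sum>i\<in>UNIV. eval_poly (partial_deriv i G) p * vec_nth v i) =
        eval_poly H p * (\<Sum>i\<in>UNIV. eval_poly (partial_deriv i F) p * vec_nth v i)"
      by (simp add: eval_partial_deriv_mult sum_distrib_left mult_ac)
    then show ?thesis using v by simp
  qed
  then show "v \<in> tangent_space (zero_locus {F}) p"
    by (simp add: tangent_space_def)
qed

text \<open>
  A coordinate vector outside the hyperplane, together with the hyperplane, spans the whole space.
\<close>

lemma dim_linear_hyperplane:
  fixes a :: "'s::finite \<Rightarrow> complex"
  assumes "a i \<noteq> 0"
  shows "Suc (vec.dim {v :: complex ^ 's. (\<Sum>j\<in>UNIV. a j * vec_nth v j) = 0}) = CARD('s)"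
proof -
  let ?T = "{v :: complex ^ 's. (\<Sum>j\<in>UNIV. a j * vec_nth v j) = 0}"
  let ?u = "axis i 1 :: complex ^ 's"
  have sub: "vec.subspace ?T"
    unfolding vec.subspace_def
    by (auto simp: distrib_left sum.distrib)
       (metis (mono_tags, lifting) mult.left_commute mult_zero_right sum.cong sum_distrib_left)
  have au: "(\<Sum>j\<in>UNIV. a j * vec_nth ?u j) = a i"
    by (simp add: axis_def if_distrib cong: if_cong)
  then have "?u \<notin> vec.span ?T"
    using assms sub unfolding vec.span_eq_iff[THEN iffD2, OF sub] by simp
  then have "vec.dim (insert ?u ?T) = Suc (vec.dim ?T)"
    by (simp add: vec.dim_insert)
  moreover have "vec.span (insert ?u ?T) = UNIV"
  proof -
    have "v \<in> vec.span (insert ?u ?T)" for v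
    proof -
      define c where "c = (\<Sum>j\<in>UNIV. a j * vec_nth v j) / a i"
      have "(\<Sum>j\<in>UNIV. a j * vec_nth (v - c *s ?u) j) =
          (\<Sum>j\<in>UNIV. a j * vec_nth v j) - c * (\<Sum>j\<in>UNIV. a j * vec_nth ?u j)"
        by (simp add: right_diff_distrib sum_subtractf sum_distrib_left mult_ac)
      also have "\<dots> = 0" unfolding au using assms by (simp add: c_def)
      finally have "v - c *s ?u \<in> vec.span (insert ?u ?T)"
        by (intro vec.span_base) simp
      moreover have "c *s ?u \<in> vec.span (insert ?u ?T)"
        by (intro vec.span_scale vec.span_base) simp
      ultimately show ?thesis
        using vec.span_add by fastforce
    qed
    then show ?thesis by blast
  qed
  ultimately show ?thesis
    using vec.dim_span[of "insert ?u ?T"] vec_dim_card[where 'a = complex and 'n = 's] by simp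
qed

lemma zariski_dim_at_hypersurface_le:
  fixes F :: "'s::finite cpoly"
  assumes "F \<noteq> 0"
  shows "zariski_dim_at (zero_locus {F}) p \<le> enat (CARD('s) - 1)"
proof -
  have "zariski_dim Z \<le> enat (CARD('s) - 1)" if "Z \<subseteq> zero_locus {F}" for Z
    unfolding zariski_dim_def
  proof (rule Sup_least)
    fix d
    assume "d \<in> {enat k | k. \<exists>W :: nat \<Rightarrow> (complex ^ 's) set.
      (\<forall>i\<le>k. irreducible_algebraic_set (W i) \<and> W i \<subseteq> Z) \<and> (\<forall>i<k. W i \<subset> W (Suc i))}"
    then obtain k W where d: "d = enat k" and W: "\<And>i. i \<le> k \<Longrightarrow> irreducible_algebraic_set (W i)"
      "\<And>i. i < k \<Longrightarrow> W i \<subset> W (Suc i)" "W k \<subseteq> Z"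
      by auto
    have "k < CARD('s)"
      using irreducible_chain_in_hypersurface[where Z = W and k = k, OF W(1,2) _ assms] W(3) that by blast
    then show "d \<le> enat (CARD('s) - 1)" by (simp add: d)
  qed
  then show ?thesis
    unfolding zariski_dim_at_def by (intro Sup_least) (auto simp: irreducible_component_def)
qed

text \<open>
  The chain through \<open>p\<close> already has the maximal length for chains inside the hypersurface, so nothing
  irreducible fits above its largest member.  This identifies an irreducible component through \<open>p\<close>
  without a decomposition of \<open>F\<close> into factors.
\<close>

lemma zariski_dim_at_smooth_point:
  fixes F :: "'s::finite cpoly"
  assumes "F \<noteq> 0" and Fp: "eval_poly F p = 0" and grad: "eval_poly (partial_deriv i F) p \<noteq> 0"
  shows "zariski_dim_at (zero_locus {F}) p = enat (CARD('s) - 1)"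
proof (rule antisym)
  let ?V = "zero_locus {F}"
  define d where "d = CARD('s) - 1"
  have d: "CARD('s) = Suc d" by (simp add: d_def)
  obtain Z where Z: "\<And>k. irreducible_algebraic_set (Z k)" "\<And>k. Z k \<subseteq> ?V" "\<And>k. p \<in> Z k"
    "\<And>k. k < d \<Longrightarrow> Z k \<subset> Z (Suc k)"
    using irreducible_chain_through_smooth_point[OF Fp grad] unfolding d Suc_less_eq by metis
  have "W = Z d" if W: "irreducible_algebraic_set W" "Z d \<subseteq> W" "W \<subseteq> ?V" for W
  proof (rule ccontr)
    assume "W \<noteq> Z d"
    have "Suc d < CARD('s)"
    proof (rule irreducible_chain_in_hypersurface[where Z = "Z(Suc d := W)", OF _ _ _ assms(1)])
      show "irreducible_algebraic_set ((Z(Suc d := W)) i)" if "i \<le> Suc d" for i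
        using Z(1)[of i] W(1) that by auto
      show "(Z(Suc d := W)) i \<subset> (Z(Suc d := W)) (Suc i)" if "i < Suc d" for i
        using Z(4)[of i] W(2) \<open>W \<noteq> Z d\<close> that by (cases "i = d") auto
      show "(Z(Suc d := W)) (Suc d) \<subseteq> ?V" using W(3) by simp
    qed
    then show False by (simp add: d)
  qed
  then have comp: "irreducible_component ?V (Z d)"
    using Z by (auto simp: irreducible_component_def)
  have below: "Z j \<subseteq> Z k" if "j \<le> k" "k \<le> d" for j k
    using that
  proof (induction k rule: dec_induct)
    case (step k)
    then show ?case using Z(4)[of k] by auto
  qed simp
  have "enat d \<le> zariski_dim (Z d)"
    unfolding zariski_dim_def
    by (rule Sup_upper) (use Z below in blast)
  also have "\<dots> \<le> zariski_dim_at ?V p"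
    unfolding zariski_dim_at_def
    by (rule Sup_upper) (use Z(3) comp in blast)
  finally show "enat (CARD('s) - 1) \<le> zariski_dim_at ?V p" by (simp add: d_def)
qed (rule zariski_dim_at_hypersurface_le[OF assms(1)])

theorem singular_locus_hypersurface:
  fixes F :: "'s::{finite,linorder} cpoly"
  assumes "\<nexists>c. F = const_poly c" "reduced_ring (coord_ring F)"
  shows "singular_locus (zero_locus {F}) =
    {p \<in> zero_locus {F}. \<forall>i. eval_poly (partial_deriv i F) p = 0}"
proof -
  have "F \<noteq> 0" using assms(1) const_poly_0 by metis
  have "enat (vec.dim (tangent_space (zero_locus {F}) p)) \<noteq> zariski_dim_at (zero_locus {F}) p \<longleftrightarrow>
      (\<forall>i. eval_poly (partial_deriv i F) p = 0)" if p: "p \<in> zero_locus {F}" for p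
  proof (cases "\<forall>i. eval_poly (partial_deriv i F) p = 0")
    case True
    then have "tangent_space (zero_locus {F}) p = UNIV"
      unfolding tangent_space_hypersurface[OF assms p] by simp
    then have "vec.dim (tangent_space (zero_locus {F}) p) = CARD('s)"
      by (simp only: vec_dim_card)
    moreover have "enat (CARD('s) - 1) < enat (CARD('s))"
      by simp
    ultimately show ?thesis
      using True zariski_dim_at_hypersurface_le[OF \<open>F \<noteq> 0\<close>, of p] by (metis leD)
  next
    case False
    then obtain i where i: "eval_poly (partial_deriv i F) p \<noteq> 0" by blast
    have "Suc (vec.dim (tangent_space (zero_locus {F}) p)) = CARD('s)"
      unfolding tangent_space_hypersurface[OF assms p]
      by (rule dim_linear_hyperplane[where a = "\<lambda>j. eval_poly (partial_deriv j F) p", OF i])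
    then have "vec.dim (tangent_space (zero_locus {F}) p) = CARD('s) - 1" by simp
    moreover have "zariski_dim_at (zero_locus {F}) p = enat (CARD('s) - 1)"
      using p i \<open>F \<noteq> 0\<close> by (intro zariski_dim_at_smooth_point) (auto simp: zero_locus_def)
    ultimately show ?thesis using False by simp
  qed
  then show ?thesis unfolding singular_locus_def by blast
qed

section \<open>Maximal minors of the Jacobian matrix\<close>

lemma mi_deriv_0: "mi_deriv 0 F = F"
proof -
  have "foldr (\<lambda>i. partial_deriv i ^^ 0) xs F = F" for xs
    by (induction xs) auto
  then show ?thesis by (simp add: mi_deriv_def)
qed

lemma mi_deriv_single: "mi_deriv (Poly_Mapping.single j 1) F = partial_deriv j F"
proof -
  have "foldr (\<lambda>i. partial_deriv i ^^ Poly_Mapping.lookup (Poly_Mapping.single j 1) i) xs F =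
      (if j \<in> set xs then partial_deriv j F else F)" if "distinct xs" for xs
    using that by (induction xs) (auto simp: lookup_single when_def)
  from this[of "sorted_list_of_set UNIV"] show ?thesis by (simp add: mi_deriv_def)
qed

lemma eval_jac_entry_not_le: "\<not> mi_le \<beta> \<alpha> \<Longrightarrow> eval_poly (jac_entry F \<beta> \<alpha>) p = 0"
  by (simp add: jac_entry_def mi_deriv_diff_def eval_poly_mult)

lemma eval_jac_entry_same: "eval_poly F p = 0 \<Longrightarrow> eval_poly (jac_entry F \<beta> \<beta>) p = 0"
  by (simp add: jac_entry_def mi_deriv_diff_def eval_poly_mult mi_deriv_0)

text \<open>
  For \<open>\<alpha> = \<beta> + e\<^sub>j\<close> the entry is a scalar multiple of \<open>\<partial>\<^sub>j F\<close>, and the scalar is nonzero because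
  \<open>\<beta> \<le> \<alpha>\<close> makes the binomial coefficient positive.
\<close>

lemma eval_jac_entry_single:
  fixes F :: "'s::{finite,linorder} cpoly"
  shows "eval_poly (jac_entry F \<beta> (\<beta> + Poly_Mapping.single j 1)) p = 0 \<longleftrightarrow> eval_poly (partial_deriv j F) p = 0"
proof -
  have nz: "mi_binomial (\<beta> + Poly_Mapping.single j 1) \<beta> \<noteq> 0" "mi_fact \<alpha> \<noteq> 0" for \<alpha> :: "'s mindex"
    by (auto simp: mi_binomial_def mi_fact_def lookup_add)
  have "mi_le \<beta> (\<beta> + Poly_Mapping.single j 1)"
    by (simp add: mi_le_def lookup_add)
  then show ?thesis
    using mi_deriv_single[of j F] nz(1)
    by (simp add: jac_entry_def mi_deriv_diff_def eval_poly_mult nz(2))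
qed

text \<open>
  The columns of a submatrix are listed by \<open>pick\<close> in increasing order; if the index set is the range of a
  strictly increasing map, that map is the listing.
\<close>

lemma pick_strict_mono_image:
  assumes "strict_mono_on {..<m} \<sigma>" "k < m"
  shows "pick (\<sigma> ` {..<m}) k = \<sigma> k"
  using assms(2)
proof (induction k)
  case 0
  then show ?case
    using strict_mono_on_leD[OF assms(1), of 0] by (auto intro!: Least_equality)
next
  case (Suc k)
  then have k: "pick (\<sigma> ` {..<m}) k = \<sigma> k" by simp
  show ?case unfolding pick.simps k
  proof (rule Least_equality)
    show "\<sigma> (Suc k) \<in> \<sigma> ` {..<m} \<and> \<sigma> k < \<sigma> (Suc k)"
      using Suc.prems strict_mono_onD[OF assms(1), of k "Suc k"] by auto
    fix y assume y: "y \<in> \<sigma> ` {..<m} \<and> \<sigma> k < y"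
    then obtain l where l: "l < m" "y = \<sigma> l" by auto
    have "k < l"
      using y l Suc.prems strict_mono_on_leD[OF assms(1), of l k] by (metis lessThan_iff Suc_lessD not_le)
    then show "\<sigma> (Suc k) \<le> y"
      using l Suc.prems strict_mono_on_leD[OF assms(1), of "Suc k" l] by simp
  qed
qed

lemma det_zero_row:
  assumes "A \<in> carrier_mat m m" "k < m" "\<And>j. j < m \<Longrightarrow> A $$ (k, j) = 0"
  shows "Determinant.det A = 0"
  using laplace_expansion_row[OF assms(1,2)] assms(3) by simp

text \<open>
  There are as many rows as the size of the minors, so a minor uses all of them, including one of degree \<open>n - 1\<close>.
  The entries of that row involve derivatives of order at most \<open>1\<close>.
\<close>

lemma eval_minors_eq_0:
  fixes F :: "'s::{finite,linorder} cpoly"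
  assumes n: "n \<ge> 1" and Fp: "eval_poly F p = 0" and grad: "\<And>i. eval_poly (partial_deriv i F) p = 0"
    and G: "G \<in> minors ((n + CARD('s) - 1) choose CARD('s)) (Jac n F)"
  shows "eval_poly G p = 0"
proof -
  define M where "M = (n + CARD('s) - 1) choose CARD('s)"
  let ?A = "Jac n F" and ?rows = "mi_list 0 (n - 1) :: 's mindex list" and ?cols = "mi_list 1 n :: 's mindex list"
  have dim: "dim_row ?A = M" "dim_col ?A = length ?cols"
    unfolding length_mi_list_columns by (simp_all add: Jac_def M_def)
  have len: "length ?rows = M"
    using length_mi_list_rows[OF n, where 's = 's] by (simp add: M_def)
  obtain I J where IJ: "G = Determinant.det (submatrix ?A I J)" "I \<subseteq> {..<M}" "J \<subseteq> {..<length ?cols}"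
    "card I = M" "card J = M"
    using G dim unfolding minors_def M_def by auto
  have I: "I = {..<M}"
    using IJ(2,4) by (intro card_subset_eq) auto
  have card: "card {i. i < dim_row ?A \<and> i \<in> I} = M" "card {j. j < dim_col ?A \<and> j \<in> J} = M"
  proof -
    have "{i. i < dim_row ?A \<and> i \<in> I} = I" "{j. j < dim_col ?A \<and> j \<in> J} = J"
      using IJ dim by auto
    then show "card {i. i < dim_row ?A \<and> i \<in> I} = M" "card {j. j < dim_col ?A \<and> j \<in> J} = M"
      using IJ by simp_all
  qed
  \<comment> \<open>any variable serves to exhibit a row of degree \<open>n - 1\<close>\<close>
  obtain i :: 's where True by simp
  have "Poly_Mapping.single i (n - 1) \<in> set ?rows"
    by (simp add: mi_list(2) mi_deg_single)
  then obtain k where k: "k < M" "?rows ! k = Poly_Mapping.single i (n - 1)"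
    unfolding in_set_conv_nth len by blast
  interpret comm_ring_hom "\<lambda>F :: 's cpoly. eval_poly F p" by (rule comm_ring_hom_eval_poly)
  have "Determinant.det (map_mat (\<lambda>F. eval_poly F p) (submatrix ?A I J)) = 0"
  proof (rule det_zero_row)
    show "map_mat (\<lambda>F. eval_poly F p) (submatrix ?A I J) \<in> carrier_mat M M"
      using card by (intro carrier_matI) (simp_all add: dim_submatrix)
    show "k < M" by (rule k)
    fix j assume j: "j < M"
    have "pick I k = k"
      using pick_strict_mono_image[of M "\<lambda>x. x" k] k by (simp add: I strict_mono_on_def)
    moreover have "pick J j \<in> J"
      using j IJ by (intro pick_in_set_le) simp
    then have c: "pick J j < length ?cols" using IJ by auto
    ultimately have "submatrix ?A I J $$ (k, j) = jac_entry F (?rows ! k) (?cols ! pick J j)"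
      using k j card dim by (subst submatrix_index) (simp_all add: Jac_def)
    moreover have "eval_poly (jac_entry F (?rows ! k) (?cols ! pick J j)) p = 0"
    proof (cases "mi_le (?rows ! k) (?cols ! pick J j)")
      case True
      have "mi_deg (?cols ! pick J j) \<le> mi_deg (?rows ! k) + 1"
        unfolding k(2) mi_deg_single using mi_list_nth_deg(2)[OF c] n by simp
      from mi_le_deg_cases[OF True this] show ?thesis
      proof cases
        case 1
        then show ?thesis using eval_jac_entry_same[OF Fp] by simp
      next
        case (2 j')
        then show ?thesis using eval_jac_entry_single[of F "?rows ! k" j' p] grad[of j'] by simp
      qed
    qed (rule eval_jac_entry_not_le)
    ultimately show "map_mat (\<lambda>F. eval_poly F p) (submatrix ?A I J) $$ (k, j) = 0"
      using k j card by (simp add: dim_submatrix)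
  qed
  then show ?thesis by (simp add: IJ(1) hom_det)
qed

text \<open>
  Suppose \<open>\<gamma>\<close> precedes \<open>\<beta>\<close> and the entry at row \<open>\<beta>\<close> and column \<open>\<gamma> + e\<^sub>i\<close> is not zero for the trivial reason that
  \<open>\<beta> \<le> \<gamma> + e\<^sub>i\<close> fails.  Comparing degrees, either \<open>\<beta> = \<gamma> + e\<^sub>i\<close>, and the entry is a multiple of \<open>F\<close>, or
  \<open>\<gamma> + e\<^sub>i = \<beta> + e\<^sub>j\<close>, and the entry is a multiple of \<open>\<partial>\<^sub>j F\<close>.  In the second case \<open>\<beta>\<close> differs from \<open>\<gamma>\<close> by one more at
  \<open>i\<close> and one less at \<open>j\<close>, and the order forces \<open>j < i\<close>.
\<close>

lemma eval_jac_entry_below_diagonal: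
  fixes F :: "'s::{finite,linorder} cpoly"
  assumes Fp: "eval_poly F p = 0" and min: "\<And>j. j < i \<Longrightarrow> eval_poly (partial_deriv j F) p = 0"
    and less: "grlex_less \<gamma> \<beta>"
  shows "eval_poly (jac_entry F \<beta> (\<gamma> + Poly_Mapping.single i 1)) p = 0"
proof (cases "mi_le \<beta> (\<gamma> + Poly_Mapping.single i 1)")
  case True
  have "mi_deg \<gamma> \<le> mi_deg \<beta>"
    using less by (auto simp: grlex_less_def)
  then have "mi_deg (\<gamma> + Poly_Mapping.single i 1) \<le> mi_deg \<beta> + 1"
    by (simp add: mi_deg_add mi_deg_single)
  from mi_le_deg_cases[OF True this] show ?thesis
  proof cases
    case 1
    then show ?thesis using eval_jac_entry_same[OF Fp, of \<beta>] by simp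
  next
    case (2 j)
    have eq: "Poly_Mapping.lookup \<gamma> k + (if i = k then 1 else 0) =
        Poly_Mapping.lookup \<beta> k + (if j = k then 1 else 0)" for k
      using arg_cong[OF 2, of "\<lambda>m. Poly_Mapping.lookup m k"]
      by (simp only: lookup_add lookup_single when_def)
    have "mi_deg \<gamma> = mi_deg \<beta>"
      using arg_cong[OF 2, of mi_deg] by (simp add: mi_deg_add mi_deg_single)
    then obtain l where l: "Poly_Mapping.lookup \<gamma> l < Poly_Mapping.lookup \<beta> l"
      "\<forall>k>l. Poly_Mapping.lookup \<gamma> k = Poly_Mapping.lookup \<beta> k"
      using less by (auto simp: grlex_less_def)
    have "l = i" "j \<noteq> i"
      using l(1) eq[of l] by (auto split: if_splits)
    moreover have "\<not> i < j"
      using l(2) eq[of j] \<open>l = i\<close> \<open>j \<noteq> i\<close> by auto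
    ultimately have "j < i" by auto
    then show ?thesis
      using 2 eval_jac_entry_single[of F \<beta> j p] min[of j] by simp
  qed
qed (rule eval_jac_entry_not_le)

text \<open>
  Adding \<open>e\<^sub>i\<close> preserves the graded lexicographical order, so the columns \<open>\<gamma> + e\<^sub>i\<close> appear in the same order as the
  rows \<open>\<gamma>\<close>, and the minor on these columns is upper triangular at \<open>p\<close>.
\<close>

lemma exists_nonzero_minor:
  fixes F :: "'s::{finite,linorder} cpoly"
  assumes n: "n \<ge> 1" and Fp: "eval_poly F p = 0" and grad: "eval_poly (partial_deriv i0 F) p \<noteq> 0"
  shows "\<exists>G\<in>minors ((n + CARD('s) - 1) choose CARD('s)) (Jac n F). eval_poly G p \<noteq> 0"
proof -
  define M where "M = (n + CARD('s) - 1) choose CARD('s)"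
  let ?A = "Jac n F" and ?rows = "mi_list 0 (n - 1) :: 's mindex list" and ?cols = "mi_list 1 n :: 's mindex list"
  have dim: "dim_row ?A = M" "dim_col ?A = length ?cols"
    unfolding length_mi_list_columns by (simp_all add: Jac_def M_def)
  have len: "length ?rows = M"
    using length_mi_list_rows[OF n, where 's = 's] by (simp add: M_def)
  define i where "i = Min {i. eval_poly (partial_deriv i F) p \<noteq> 0}"
  have i: "eval_poly (partial_deriv i F) p \<noteq> 0"
    using Min_in[of "{i. eval_poly (partial_deriv i F) p \<noteq> 0}"] grad by (auto simp: i_def)
  have min: "eval_poly (partial_deriv j F) p = 0" if "j < i" for j
  proof (rule ccontr)
    assume "eval_poly (partial_deriv j F) p \<noteq> 0"
    then have "i \<le> j" unfolding i_def by (intro Min_le) auto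
    then show False using that by simp
  qed
  have "\<exists>u < length ?cols. ?cols ! u = ?rows ! k + Poly_Mapping.single i 1" if "k < M" for k
  proof -
    have "mi_deg (?rows ! k) \<le> n - 1"
      using that len by (intro mi_list_nth_deg(2)) simp
    then have "?rows ! k + Poly_Mapping.single i 1 \<in> set ?cols"
      unfolding mi_list(2) using n by (simp add: mi_deg_add mi_deg_single)
    then show ?thesis by (simp add: in_set_conv_nth)
  qed
  then obtain \<sigma> where \<sigma>: "\<And>k. k < M \<Longrightarrow> \<sigma> k < length ?cols"
    "\<And>k. k < M \<Longrightarrow> ?cols ! \<sigma> k = ?rows ! k + Poly_Mapping.single i 1"
    by metis
  have mono: "strict_mono_on {..<M} \<sigma>"
  proof (rule strict_mono_onI)
    fix a b assume ab: "a \<in> {..<M}" "b \<in> {..<M}" "a < b"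
    then have "grlex_less (?rows ! a) (?rows ! b)"
      using ab len by (subst mi_list_nth_less_iff[OF refl]) simp_all
    then have "grlex_less (?cols ! \<sigma> a) (?cols ! \<sigma> b)"
      using ab \<sigma>(2)[of a] \<sigma>(2)[of b] by (simp add: grlex_less_add_right)
    then show "\<sigma> a < \<sigma> b"
      using ab \<sigma>(1) by (subst (asm) mi_list_nth_less_iff[OF refl]) simp_all
  qed
  \<comment> \<open>the columns \<open>\<gamma> + e\<^sub>i\<close>, where \<open>\<gamma>\<close> runs through the row indices\<close>
  define J where "J = \<sigma> ` {..<M}"
  define B where "B = map_mat (\<lambda>F. eval_poly F p) (submatrix ?A {..<M} J)"
  have cardJ: "card J = M"
    unfolding J_def using strict_mono_on_imp_inj_on[OF mono] by (simp add: card_image)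
  have J: "J \<subseteq> {..<length ?cols}"
    using \<sigma>(1) by (auto simp: J_def)
  have sets: "{i. i < dim_row ?A \<and> i \<in> {..<M}} = {..<M}" "{j. j < dim_col ?A \<and> j \<in> J} = J"
    using J dim by auto
  have B_dim: "B \<in> carrier_mat M M"
    unfolding B_def using cardJ by (intro carrier_matI) (simp_all add: dim_submatrix sets dim(1))
  have B: "B $$ (a, b) = eval_poly (jac_entry F (?rows ! a) (?rows ! b + Poly_Mapping.single i 1)) p"
    if "a < M" "b < M" for a b
  proof -
    have "pick {..<M} a = a" "pick J b = \<sigma> b"
      using pick_strict_mono_image[of M "\<lambda>x. x" a] pick_strict_mono_image[OF mono, of b] that
      by (simp_all add: J_def strict_mono_on_def)
    then have "submatrix ?A {..<M} J $$ (a, b) = ?A $$ (a, \<sigma> b)"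
      using that cardJ by (subst submatrix_index) (simp_all only: sets card_lessThan)
    also have "\<dots> = jac_entry F (?rows ! a) (?cols ! \<sigma> b)"
      using that \<sigma>(1)[OF that(2)] dim by (simp add: Jac_def)
    finally show ?thesis
      using that cardJ \<sigma>(2)[OF that(2)] by (simp add: B_def dim_submatrix sets dim(1))
  qed
  have "upper_triangular B"
  proof (rule upper_triangularI)
    fix a b assume ab: "b < a" "a < dim_row B"
    then have "grlex_less (?rows ! b) (?rows ! a)"
      using B_dim len by (subst mi_list_nth_less_iff[OF refl]) simp_all
    then show "B $$ (a, b) = 0"
      using ab B_dim B[of a b] eval_jac_entry_below_diagonal[OF Fp min] by simp
  qed
  then have "Determinant.det B = prod_list (diag_mat B)"
    using B_dim by (rule det_upper_triangular)
  moreover have "B $$ (a, a) \<noteq> 0" if "a < M" for a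
    using B[OF that that] eval_jac_entry_single[of F "?rows ! a" i p] i by simp
  ultimately have "Determinant.det B \<noteq> 0"
    using B_dim by (auto simp: prod_list_zero_iff diag_mat_def)
  moreover have "Determinant.det B = eval_poly (Determinant.det (submatrix ?A {..<M} J)) p"
    unfolding B_def by (rule comm_ring_hom.hom_det[OF comm_ring_hom_eval_poly])
  moreover have "Determinant.det (submatrix ?A {..<M} J) \<in> minors M ?A"
    unfolding minors_def mem_Collect_eq using J cardJ dim
    by (intro exI[of _ "{..<M}"] exI[of _ J]) auto
  ultimately show ?thesis unfolding M_def by force
qed

theorem corollary2p2:
  fixes F :: "'s::{finite,linorder} cpoly" and n :: nat
  assumes "n \<ge> 1"
    and "\<nexists>c. F = const_poly c"
    and "reduced_ring (coord_ring F)"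
  shows "singular_locus (zero_locus {F}) = zero_set_in (zero_locus {F}) (jac_ideal n F)"
proof -
  have "(\<forall>i. eval_poly (partial_deriv i F) p = 0) \<longleftrightarrow>
      (\<forall>G\<in>minors ((n + CARD('s) - 1) choose CARD('s)) (Jac n F). eval_poly G p = 0)"
    if "p \<in> zero_locus {F}" for p
  proof -
    have Fp: "eval_poly F p = 0" using that by (simp add: zero_locus_def)
    show ?thesis
      using eval_minors_eq_0[OF assms(1) Fp] exists_nonzero_minor[OF assms(1) Fp] by blast
  qed
  then show ?thesis
    unfolding singular_locus_hypersurface[OF assms(2,3)] zero_set_in_jac_ideal by blast
qed

end
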